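(* Let $m>0$ and let $\varphi_1,\dots,\varphi_n\in H^1(\mathbb{S}^2)$ be scalar functions with zero mean, $\int_{\mathbb{S}^2}\varphi_j(s)\,dS=0$, that are orthonormal in the sense that $$m^2(\varphi_i,\varphi_j)_{L^2}+(\nabla\varphi_i,\nabla\varphi_j)_{L^2}=\delta_{ij},\qquad i,j=1,\dots,n.$$ Then the function $\rho(s):=\sum_{j=1}^n|\varphi_j(s)|^2$ satisfies $$\|\rho\|_{L^2}\le\frac1{2\sqrt{\pi}}\,m^{-1}n^{1/2}.$$
   Context: $\mathbb{S}^2$ is the unit two-dimensional sphere with its standard metric and area element $dS$; $\nabla$ is the surface gradient; $(\cdot,\cdot)_{L^2}$ is the $L^2(\mathbb{S}^2)$ scalar product (of functions or of tangent vector fields) and $\|\cdot\|_{L^2}$ is the $L^2(\mathbb{S}^2)$ norm; $\delta_{ij}$ is the Kronecker symbol. *)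

theory Defs
  imports "HOL-Analysis.Analysis"
begin

definition S2 :: "(real^3) set" where
  "S2 = sphere 0 1"

definition spherical_coords :: "real \<times> real \<Rightarrow> real^3" where
  "spherical_coords = (\<lambda>(\<theta>, \<phi>). vector [sin \<theta> * cos \<phi>, sin \<theta> * sin \<phi>, cos \<theta>])"

text \<open>The area element is \<open>sin \<theta> d\<theta> d\<phi>\<close> in spherical coordinates; the space of the resulting
  measure is the sphere itself, so values of functions off the sphere are irrelevant.\<close>

definition area_S2 :: "(real^3) measure" where
  "area_S2 = distr
     (density lborel (\<lambda>(\<theta>, \<phi>). ennreal (sin \<theta>) * indicator ({0..pi} \<times> {0..2*pi}) (\<theta>, \<phi>)))
     (restrict_space borel S2) spherical_coords"

text \<open>The following are used both for scalar functions (\<open>'a = real\<close>, where \<open>\<bullet>\<close> is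
  multiplication) and for vector fields (\<open>'a = real^3\<close>).\<close>

definition L2_S2 :: "(real^3 \<Rightarrow> 'a::euclidean_space) set" where
  "L2_S2 = {f \<in> borel_measurable area_S2. integrable area_S2 (\<lambda>s. (norm (f s))\<^sup>2)}"

definition L2_inner :: "(real^3 \<Rightarrow> 'a::euclidean_space) \<Rightarrow> (real^3 \<Rightarrow> 'a) \<Rightarrow> real" where
  "L2_inner f g = (LINT s|area_S2. f s \<bullet> g s)"

text \<open>This is the \<open>L\<^sup>2\<close> norm only for members of \<^const>\<open>L2_S2\<close>: the Bochner integral of a
  non-integrable function is \<open>0\<close>.\<close>

definition L2_norm :: "(real^3 \<Rightarrow> 'a::euclidean_space) \<Rightarrow> real" where
  "L2_norm f = sqrt (L2_inner f f)"

definition tangent_field :: "(real^3 \<Rightarrow> real^3) \<Rightarrow> bool" where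
  "tangent_field X \<longleftrightarrow> (\<forall>s\<in>S2. X s \<bullet> s = 0)"

text \<open>A derivative within the sphere is determined only on tangent vectors, so \<open>D\<close> below is not
  unique, but composing it with the tangential projection gives a canonical choice that is again
  continuous.\<close>

definition C1_field :: "(real^3 \<Rightarrow> real^3) \<Rightarrow> bool" where
  "C1_field X \<longleftrightarrow> (\<exists>D :: real^3 \<Rightarrow> ((real^3) \<Rightarrow>\<^sub>L (real^3)). continuous_on S2 D \<and>
     (\<forall>s\<in>S2. (X has_derivative blinfun_apply (D s)) (at s within S2)))"

text \<open>The trace of the tangential derivative \<open>v \<mapsto> D v\<close> on the tangent plane at \<open>s\<close>, written as the
  trace of \<open>D \<circ> P\<close> on the ambient space with \<open>P b = b - (b \<bullet> s) s\<close>. It does not depend on the choice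
  made by \<^const>\<open>frechet_derivative\<close>, see \<open>surface_div_eq\<close> below.\<close>

definition surface_div :: "(real^3 \<Rightarrow> real^3) \<Rightarrow> real^3 \<Rightarrow> real" where
  "surface_div X s =
     (\<Sum>b\<in>Basis. frechet_derivative X (at s within S2) (b - (b \<bullet> s) *\<^sub>R s) \<bullet> b)"

text \<open>The weak gradient is defined by duality with \<open>C\<^sup>1\<close> tangent fields.\<close>

definition has_weak_surface_gradient :: "(real^3 \<Rightarrow> real) \<Rightarrow> (real^3 \<Rightarrow> real^3) \<Rightarrow> bool" where
  "has_weak_surface_gradient f G \<longleftrightarrow> f \<in> L2_S2 \<and> G \<in> L2_S2 \<and> tangent_field G \<and>
     (\<forall>X. C1_field X \<and> tangent_field X \<longrightarrow> L2_inner G X = - L2_inner f (surface_div X))"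

definition H1_S2 :: "(real^3 \<Rightarrow> real) set" where
  "H1_S2 = {f. \<exists>G. has_weak_surface_gradient f G}"

text \<open>The weak gradient is unique up to null sets; \<open>surface_grad\<close> picks a representative.\<close>

definition surface_grad :: "(real^3 \<Rightarrow> real) \<Rightarrow> real^3 \<Rightarrow> real^3" where
  "surface_grad f = (SOME G. has_weak_surface_gradient f G)"

lemma spherical_coords_in_S2: "spherical_coords p \<in> S2"
proof -
  obtain a b where p: "p = (a, b)" by fastforce
  have "(sin a * cos b)\<^sup>2 + (sin a * sin b)\<^sup>2 + (cos a)\<^sup>2 = (sin a)\<^sup>2 * ((cos b)\<^sup>2 + (sin b)\<^sup>2) + (cos a)\<^sup>2"
    by (simp only: power_mult_distrib distrib_left)
  also have "\<dots> = 1"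
    by simp
  finally show ?thesis
    by (simp add: p S2_def spherical_coords_def norm_vec_def L2_set_def sum_3)
qed

lemma space_area_S2 [simp]: "space area_S2 = S2"
  by (simp add: area_S2_def space_restrict_space)

lemma sets_area_S2 [simp]: "sets area_S2 = sets (restrict_space borel S2)"
  by (simp add: area_S2_def)

lemma spherical_coords_measurable [measurable]:
  "spherical_coords \<in> borel \<rightarrow>\<^sub>M restrict_space borel S2"
proof (rule measurable_restrict_space2)
  have "continuous_on UNIV spherical_coords"
  proof (subst continuous_on_componentwise, rule ballI)
    fix b :: "real^3" assume "b \<in> Basis"
    then obtain i where b: "b = axis i 1" by (auto simp: Basis_vec_def)
    show "continuous_on UNIV (\<lambda>x. spherical_coords x \<bullet> b)"
    proof -
      consider "i = 1" | "i = 2" | "i = 3" using exhaust_3 by blast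
      then show ?thesis
        by cases (simp_all add: b inner_axis spherical_coords_def case_prod_unfold continuous_intros)
    qed
  qed
  then show "spherical_coords \<in> borel \<rightarrow>\<^sub>M borel"
    by (rule borel_measurable_continuous_onI)
qed (use spherical_coords_in_S2 in auto)

lemma emeasure_area_S2: "emeasure area_S2 S2 = ennreal (4 * pi)"
proof -
  let ?d = "\<lambda>(\<theta>, \<phi>). ennreal (sin \<theta>) * indicator ({0..pi} \<times> {0..2*pi}) (\<theta>, \<phi>) :: ennreal"
  have d [measurable]: "?d \<in> borel_measurable (lborel \<Otimes>\<^sub>M lborel)"
    by measurable
  have m: "spherical_coords \<in> density lborel ?d \<rightarrow>\<^sub>M restrict_space borel S2"
    using spherical_coords_measurable by (simp add: measurable_cong_sets[OF sets_lborel refl] measurable_density_eq1)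
  have "S2 \<in> sets (restrict_space borel S2)"
    using sets.top[of "restrict_space borel S2"] by (simp add: space_restrict_space)
  then have "emeasure area_S2 S2 = emeasure (density lborel ?d) UNIV"
    unfolding area_S2_def by (subst emeasure_distr[OF m]) (simp_all add: vimage_def spherical_coords_in_S2)
  also have "\<dots> = (\<integral>\<^sup>+p. ?d p \<partial>lborel)"
    using d by (subst emeasure_density) (simp_all add: lborel_prod)
  also have "\<dots> = (\<integral>\<^sup>+x. \<integral>\<^sup>+y. ?d (x, y) \<partial>lborel \<partial>lborel)"
    using lborel.nn_integral_fst[OF d] by (simp add: lborel_prod)
  also have "\<dots> = (\<integral>\<^sup>+x. (ennreal (sin x) * indicator {0..pi} x) * ennreal (2 * pi) \<partial>lborel)"
  proof (rule nn_integral_cong)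
    fix x :: real
    have "(\<integral>\<^sup>+y. ?d (x, y) \<partial>lborel)
        = (\<integral>\<^sup>+y. (ennreal (sin x) * indicator {0..pi} x) * indicator {0..2*pi} y \<partial>lborel)"
      by (intro nn_integral_cong) (simp add: indicator_times mult.assoc)
    also have "\<dots> = (ennreal (sin x) * indicator {0..pi} x) * ennreal (2 * pi)"
      by (subst nn_integral_cmult_indicator) simp_all
    finally show "(\<integral>\<^sup>+y. ?d (x, y) \<partial>lborel) = (ennreal (sin x) * indicator {0..pi} x) * ennreal (2 * pi)" .
  qed
  also have "\<dots> = (\<integral>\<^sup>+x. ennreal (sin x) * indicator {0..pi} x \<partial>lborel) * ennreal (2 * pi)"
    by (rule nn_integral_multc) measurable
  also have "(\<integral>\<^sup>+x. ennreal (sin x) * indicator {0..pi} x \<partial>lborel) = ennreal (- cos pi - (- cos 0))"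
    by (rule nn_integral_FTC_Icc)
       (auto intro!: derivative_eq_intros sin_ge_zero simp flip: has_real_derivative_iff_has_vector_derivative)
  also have "\<dots> * ennreal (2 * pi) = ennreal (4 * pi)"
    using ennreal_mult[of 2 "2 * pi"] by simp
  finally show ?thesis .
qed

lemma surface_div_eq:
  assumes D: "(X has_derivative D) (at s within S2)" and s: "s \<in> S2"
  shows "surface_div X s = (\<Sum>b\<in>Basis. D (b - (b \<bullet> s) *\<^sub>R s) \<bullet> b)"
proof -
  have uniq: "D1 v = D2 v"
    if D1: "(X has_derivative D1) (at s within S2)" and D2: "(X has_derivative D2) (at s within S2)"
      and v: "v \<bullet> s = 0" for D1 D2 v
  proof (cases "v = 0")
    case True
    with D1 D2 show ?thesis
      by (simp add: linear_0 bounded_linear.linear has_derivative_bounded_linear)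
  next
    case False
    define u where "u = v /\<^sub>R norm v"
    define c where "c = (\<lambda>t::real. cos t *\<^sub>R s + sin t *\<^sub>R u)"
    have ss: "s \<bullet> s = 1" using s by (simp add: S2_def dot_square_norm)
    have uu: "u \<bullet> u = 1" using False by (simp add: u_def dot_square_norm power2_eq_square)
    have us: "u \<bullet> s = 0" "s \<bullet> u = 0" using v by (simp_all add: u_def inner_commute)
    have cS: "c t \<in> S2" for t
    proof -
      have "c t \<bullet> c t = cos t * cos t + sin t * sin t"
        by (simp add: c_def inner_add_left inner_add_right ss uu us)
      also have "\<dots> = 1"
        using sin_cos_squared_add[of t] by (simp add: power2_eq_square)
      finally show ?thesis by (simp add: S2_def norm_eq_1)
    qed
    have c0: "c 0 = s" by (simp add: c_def)
    have cd: "(c has_derivative (\<lambda>t. t *\<^sub>R u)) (at 0)"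
      unfolding c_def by (auto intro!: derivative_eq_intros)
    have comp: "((X \<circ> c) has_derivative (\<lambda>t. E (t *\<^sub>R u))) (at 0)"
      if "(X has_derivative E) (at s within S2)" for E
    proof -
      have "(X has_derivative E) (at (c 0) within c ` UNIV)"
        using that cS by (auto simp: c0 intro: has_derivative_subset)
      from diff_chain_within[OF cd this] show ?thesis by (simp add: o_def)
    qed
    have "(\<lambda>t. D1 (t *\<^sub>R u)) = (\<lambda>t. D2 (t *\<^sub>R u))"
      by (rule has_derivative_unique[OF comp[OF D1] comp[OF D2]])
    from fun_cong[OF this, of "norm v"] show ?thesis
      using False by (simp add: u_def)
  qed
  have F: "(X has_derivative frechet_derivative X (at s within S2)) (at s within S2)"
    using D frechet_derivative_works differentiable_def by blast
  have "s \<bullet> s = 1" using s by (simp add: S2_def dot_square_norm)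
  then have "(b - (b \<bullet> s) *\<^sub>R s) \<bullet> s = 0" for b
    by (simp add: inner_diff_left)
  with uniq[OF F D] show ?thesis by (simp add: surface_div_def)
qed

end

theory Submission
  imports Defs "HOL-Computational_Algebra.Polynomial"
begin

text \<open>
  For a polynomial probability kernel \<open>k(s \<bullet> t)\<close> on the sphere, an expansion in Legendre polynomials
  yields a polynomial \<open>g\<close> with \<open>m\<^sup>2 g - ((1 - x\<^sup>2) g')' = k - 1/(4\<pi>)\<close>, and the norm of \<open>g(s \<bullet> _)\<close> is
  governed by the sum of \<open>(2l + 1) / (m\<^sup>2 + l(l + 1))\<^sup>2\<close>, which telescopes to at most \<open>1/m\<^sup>2\<close>. In the energy
  scalar product, \<open>g(s \<bullet> _)\<close> represents the smoothing \<open>K \<phi>(s)\<close> of a mean-zero function \<open>\<phi>\<close>, so by Bessel's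
  inequality the kernel \<open>H(s, r) - \<Sum>\<^sub>j K \<phi>\<^sub>j(s) K \<phi>\<^sub>j(r)\<close> is positive semidefinite, where \<open>H\<close> is the Gram
  kernel of the functions \<open>g(s \<bullet> _)\<close>. Testing this positivity against the smoothed density
  \<open>V = \<Sum>\<^sub>j (K \<phi>\<^sub>j)\<^sup>2\<close> itself bounds the norm of \<open>V\<close>; letting \<open>k\<close> concentrate and
  applying Fatou's lemma gives the bound for \<open>\<rho>\<close>.
\<close>

section \<open>Legendre polynomials\<close>

text \<open>In dimension two point evaluation is unbounded on H^1: the exact Green function of the
  energy form has a logarithmic singularity, so its energy norm, the diagonal of the Gram kernel, is
  infinite, and members of H^1 need not have values at points. Polynomial smoothing repairs both.
  The final estimate is uniform in the smoothing because it uses only the L2 norms of the rows of H,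
  where squared eigenvalues in the denominators make the sum over l converge. All kernels depend on
  inner products alone, which reduces the spectral theory to one-dimensional Legendre expansions.
  The zero mean removes l = 0, whose term would add a multiple of 1/m^4. Origin of the constant: a
  kernel of mass one has Legendre coefficients at most (2l+1)/(4 pi), so each row of H has squared
  norm at most E = 1/(4 pi m^2). With R the sum of the products of the smoothed functions,
  positivity compares the Hilbert-Schmidt norms of R and H under the weight V(s) V(r).
  Cauchy-Schwarz for the trace of an n by n matrix costs a factor n, so that the squared norm X of V
  satisfies X^2 <= n E X, and sqrt(n E) is the asserted bound.\<close>

definition poly_int :: "real poly \<Rightarrow> real" where
  "poly_int p = integral {-1..1} (poly p)"

lemma poly_integrable: "poly (p :: real poly) integrable_on {-1..1}"
  by (intro integrable_continuous_interval continuous_intros)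

lemma poly_int_add: "poly_int (p + q) = poly_int p + poly_int q"
  by (simp add: poly_int_def poly_add[abs_def] integral_add poly_integrable)

lemma poly_int_smult: "poly_int (smult c p) = c * poly_int p"
  by (simp add: poly_int_def poly_smult[abs_def])

lemma poly_int_minus: "poly_int (- p) = - poly_int p"
  using poly_int_smult[of "-1" p] by simp

lemma poly_int_0: "poly_int 0 = 0"
  using poly_int_smult[of 0 0] by simp

lemma poly_int_sum: "poly_int (\<Sum>i\<in>A. f i) = (\<Sum>i\<in>A. poly_int (f i))"
  by (induction A rule: infinite_finite_induct) (simp_all add: poly_int_0 poly_int_add)

lemma poly_int_pderiv: "poly_int (pderiv p) = poly p 1 - poly p (-1)"
  unfolding poly_int_def
  by (rule integral_unique, rule fundamental_theorem_of_calculus)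
     (auto simp flip: has_real_derivative_iff_has_vector_derivative intro: DERIV_subset[OF poly_DERIV])

lemma poly_int_mono:
  assumes "\<And>x. x \<in> {-1..1} \<Longrightarrow> poly p x \<le> poly q x"
  shows "poly_int p \<le> poly_int q"
  unfolding poly_int_def by (intro integral_le poly_integrable assms)

lemma smult_sum_right: "smult c (\<Sum>i\<in>A. f i) = (\<Sum>i\<in>A. smult c (f i))"
  by (induction A rule: infinite_finite_induct) (simp_all add: smult_add_right)

text \<open>With x = s \<bullet> t this is the Laplace-Beltrami operator acting on functions of x;
  \<open>[:1, 0, -1:]\<close> is the weight 1 - x^2.\<close>

definition legendre_op :: "real poly \<Rightarrow> real poly" where
  "legendre_op p = pderiv ([:1, 0, -1:] * pderiv p)"

lemma legendre_op_add: "legendre_op (p + q) = legendre_op p + legendre_op q"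
  by (simp add: legendre_op_def pderiv_add distrib_left)

lemma legendre_op_smult: "legendre_op (smult c p) = smult c (legendre_op p)"
  by (simp only: legendre_op_def pderiv_smult mult_smult_right)

lemma legendre_op_diff: "legendre_op (p - q) = legendre_op p - legendre_op q"
  using legendre_op_add[of p "smult (-1) q"] by (simp only: legendre_op_smult) simp

lemma legendre_op_0: "legendre_op 0 = 0"
  using legendre_op_smult[of 0 0] by simp

lemma legendre_op_sum: "legendre_op (\<Sum>i\<in>A. f i) = (\<Sum>i\<in>A. legendre_op (f i))"
  by (induction A rule: infinite_finite_induct) (simp_all add: legendre_op_0 legendre_op_add)

lemma poly_legendre_op:
  "poly (legendre_op p) x = (1 - x\<^sup>2) * poly (pderiv (pderiv p)) x - 2 * x * poly (pderiv p) x"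
  unfolding legendre_op_def pderiv_mult
  by (simp add: pderiv_pCons algebra_simps power2_eq_square del: mult_pCons_left)

text \<open>Integration by parts; the boundary terms disappear because the weight 1 - x^2 vanishes
  at both ends.\<close>

lemma poly_int_legendre_op_mult:
  "poly_int (p * legendre_op q) = - poly_int ([:1, 0, -1:] * pderiv p * pderiv q)"
proof -
  define w where "w = [:1, 0, -1 :: real:]"
  have "pderiv (p * (w * pderiv q)) = p * legendre_op q + w * pderiv p * pderiv q"
    by (simp add: legendre_op_def w_def[symmetric] pderiv_mult algebra_simps)
  moreover have "poly_int (pderiv (p * (w * pderiv q))) = 0"
    by (simp add: poly_int_pderiv w_def)
  ultimately show ?thesis
    by (simp add: poly_int_add w_def)
qed

lemma poly_int_legendre_op_sym: "poly_int (p * legendre_op q) = poly_int (q * legendre_op p)"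
  unfolding poly_int_legendre_op_mult by (simp only: mult.assoc mult.commute[of "pderiv p"])

text \<open>In z = x - 1 the weight is -z^2 - 2z, so z^k is sent to a combination of z^k and z^(k-1)
  only, and the eigenvalue equation becomes a two-term recursion for the coefficients. For k = 0 the
  truncated exponent k - 1 is harmless, as its coefficient is 0.\<close>

lemma legendre_op_linear_power:
  "legendre_op ([:-1, 1:] ^ k) =
     - smult (real k * (real k + 1)) ([:-1, 1:] ^ k) - smult (2 * (real k)\<^sup>2) ([:-1, 1:] ^ (k - 1))"
proof (cases k)
  case (Suc j)
  define z where "z = [:-1, 1 :: real:]"
  have dz: "pderiv (z ^ Suc i) = smult (real (Suc i)) (z ^ i)" for i
    by (simp add: pderiv_power_Suc z_def pderiv_pCons del: power_Suc)
  have w: "[:1, 0, -1:] = - (z * z) - smult 2 z"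
    by (simp add: z_def)
  have "[:1, 0, -1:] * pderiv (z ^ Suc j)
      = smult (real (Suc j)) (- (z ^ Suc (Suc j)) - smult 2 (z ^ Suc j))"
    unfolding w dz by (simp add: algebra_simps smult_diff_right smult_minus_right)
  then have "legendre_op (z ^ Suc j)
      = smult (real (Suc j)) (- smult (real (Suc (Suc j))) (z ^ Suc j) - smult (2 * real (Suc j)) (z ^ j))"
    by (simp only: legendre_op_def pderiv_smult pderiv_diff pderiv_minus dz smult_smult)
  also have "\<dots> = - smult (real (Suc j) * (real (Suc j) + 1)) (z ^ Suc j) - smult (2 * (real (Suc j))\<^sup>2) (z ^ j)"
    by (simp add: smult_diff_right power2_eq_square algebra_simps del: power_Suc)
  finally show ?thesis
    by (simp add: Suc z_def del: power_Suc)
qed (simp add: legendre_op_def pderiv_1)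

text \<open>The coefficients of the expansion in powers of \<open>x - 1\<close>, in which \<open>P\<^sub>l(1) = 1\<close> is obvious.\<close>

definition legendre_coeff :: "nat \<Rightarrow> nat \<Rightarrow> real" where
  "legendre_coeff l k =
     (\<Prod>i<k. (real l * (real l + 1) - real i * (real i + 1)) / (2 * (real i + 1)\<^sup>2))"

definition legendre :: "nat \<Rightarrow> real poly" where
  "legendre l = (\<Sum>k\<le>l. smult (legendre_coeff l k) ([:-1, 1:] ^ k))"

text \<open>The recursion \<open>rec\<close> compares the coefficients of z^k in the eigenvalue
  equation. The series stops at l because the factor i = l in the product for
  \<open>legendre_coeff l (Suc l)\<close> is 0.\<close>

lemma legendre_op_legendre: "legendre_op (legendre l) = smult (- (real l * (real l + 1))) (legendre l)"
proof -
  let ?z = "\<lambda>k. [:-1, 1 :: real:] ^ k" and ?c = "legendre_coeff l" and ?L = "real l * (real l + 1)"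
  have rec: "?c (Suc k) * (2 * (real (Suc k))\<^sup>2) = (?L - real k * (real k + 1)) * ?c k" for k
    by (simp add: legendre_coeff_def add_ac)
  have c0: "?c (Suc l) = 0"
    by (simp add: legendre_coeff_def)
  have "legendre_op (legendre l)
      = (\<Sum>k\<le>l. smult (?c k) (- smult (real k * (real k + 1)) (?z k) - smult (2 * (real k)\<^sup>2) (?z (k - 1))))"
    by (simp only: legendre_def legendre_op_sum legendre_op_smult legendre_op_linear_power)
  also have "\<dots> = (\<Sum>k\<le>l. smult (- (?c k * (real k * (real k + 1)))) (?z k))
                 - (\<Sum>k\<le>l. smult (?c k * (2 * (real k)\<^sup>2)) (?z (k - 1)))"
    by (simp add: sum_subtractf[symmetric] smult_diff_right)
  \<comment> \<open>The added term k = l + 1 is zero by \<open>c0\<close>, and k = 0 drops out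
    through its factor k^2; after the shift both sums run over the same powers.\<close>
  also have "(\<Sum>k\<le>l. smult (?c k * (2 * (real k)\<^sup>2)) (?z (k - 1)))
      = (\<Sum>k\<le>Suc l. smult (?c k * (2 * (real k)\<^sup>2)) (?z (k - 1)))"
    by (simp add: c0)
  also have "\<dots> = (\<Sum>k\<le>l. smult (?c (Suc k) * (2 * (real (Suc k))\<^sup>2)) (?z k))"
    by (subst sum.atMost_Suc_shift) simp
  also have "\<dots> = (\<Sum>k\<le>l. smult ((?L - real k * (real k + 1)) * ?c k) (?z k))"
    by (simp only: rec)
  also have "(\<Sum>k\<le>l. smult (- (?c k * (real k * (real k + 1)))) (?z k))
      - (\<Sum>k\<le>l. smult ((?L - real k * (real k + 1)) * ?c k) (?z k)) = smult (- ?L) (legendre l)"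
    unfolding legendre_def smult_sum_right sum_subtractf[symmetric]
    by (intro sum.cong refl) (simp add: smult_diff_left[symmetric] algebra_simps del: smult_minus_left)
  finally show ?thesis .
qed

lemma poly_legendre_1: "poly (legendre l) 1 = 1"
proof -
  have "poly (legendre l) 1 = (\<Sum>k\<le>l. legendre_coeff l k * 0 ^ k)"
    by (simp add: legendre_def poly_sum)
  also have "\<dots> = legendre_coeff l 0"
    by (subst sum.remove[of _ 0]) (auto intro!: sum.neutral)
  finally show ?thesis
    by (simp add: legendre_coeff_def)
qed

lemma degree_legendre_le: "degree (legendre l) \<le> l"
  unfolding legendre_def
  by (rule degree_sum_le) (auto intro!: order.trans[OF degree_smult_le] simp: degree_linear_power)

text \<open>The factors of the leading coefficient are nonzero since i(i+1) is strictly increasing.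
  This lets \<open>poly_eq_sum_legendre\<close> strip off leading terms one by one.\<close>

lemma coeff_legendre_neq_0: "coeff (legendre l) l \<noteq> 0"
proof -
  have "coeff (legendre l) l = (\<Sum>k\<le>l. legendre_coeff l k * coeff ([:-1, 1:] ^ k) l)"
    by (simp add: legendre_def coeff_sum)
  also have "\<dots> = legendre_coeff l l * coeff ([:-1, 1:] ^ l) l"
    by (subst sum.remove[of _ l]) (auto intro!: sum.neutral coeff_eq_0 simp: degree_linear_power)
  also have "coeff ([:-1, 1 :: real:] ^ l) l = 1"
    using lead_coeff_power[of "[:-1, 1 :: real:]" l] by (simp add: degree_linear_power)
  finally have "coeff (legendre l) l = legendre_coeff l l" by simp
  moreover have "real l * (real l + 1) - real i * (real i + 1) \<noteq> 0" if "i < l" for i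
  proof -
    have "real i * (real i + 1) < real l * (real l + 1)"
      using that by (intro mult_strict_mono) auto
    then show ?thesis by simp
  qed
  ultimately show ?thesis
    by (simp add: legendre_coeff_def prod_zero_iff power2_eq_square add_eq_0_iff_both_eq_0)
qed

lemma poly_eq_sum_legendre:
  assumes "degree p < n"
  shows "\<exists>a. p = (\<Sum>l<n. smult (a l) (legendre l))"
  using assms
proof (induction n arbitrary: p)
  case (Suc n)
  define c where "c = coeff p n / coeff (legendre n) n"
  define q where "q = p - smult c (legendre n)"
  have "degree q \<le> n"
    unfolding q_def using Suc.prems degree_legendre_le[of n]
    by (intro degree_diff_le order.trans[OF degree_smult_le]) auto
  moreover have cq: "coeff q n = 0"
    by (simp add: q_def c_def coeff_legendre_neq_0)
  ultimately consider "degree q < n" | "q = 0"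
    by (metis le_neq_implies_less leading_coeff_0_iff)
  then obtain a where "q = (\<Sum>l<n. smult (a l) (legendre l))"
  proof cases
    case 1
    from Suc.IH[OF this] that show ?thesis by blast
  next
    case 2
    then show ?thesis using that[of "\<lambda>_. 0"] by simp
  qed
  then have "p = (\<Sum>l<Suc n. smult ((a(n := c)) l) (legendre l))"
    by (simp add: q_def algebra_simps)
  then show ?case by blast
qed simp

text \<open>The operator is symmetric and its eigenvalues l(l+1) are distinct.\<close>

lemma legendre_orthogonal:
  assumes "j \<noteq> l"
  shows "poly_int (legendre j * legendre l) = 0"
proof -
  have "- (real l * (real l + 1)) * poly_int (legendre j * legendre l)
      = - (real j * (real j + 1)) * poly_int (legendre j * legendre l)"
    using poly_int_legendre_op_sym[of "legendre j" "legendre l"]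
    by (simp only: legendre_op_legendre mult_smult_right poly_int_smult mult.commute)
  moreover have "real l * (real l + 1) \<noteq> real j * (real j + 1)"
  proof (cases "j < l")
    case True
    then have "real j * (real j + 1) < real l * (real l + 1)"
      by (intro mult_strict_mono) auto
    then show ?thesis by simp
  next
    case False
    then have "real l * (real l + 1) < real j * (real j + 1)"
      using assms by (intro mult_strict_mono) auto
    then show ?thesis by simp
  qed
  ultimately show ?thesis by simp
qed

lemma legendre_orthogonal_lower:
  assumes "degree q < l"
  shows "poly_int (legendre l * q) = 0"
proof -
  from poly_eq_sum_legendre[OF assms] obtain a where "q = (\<Sum>j<l. smult (a j) (legendre j))" ..
  then have "poly_int (legendre l * q) = (\<Sum>j<l. a j * poly_int (legendre l * legendre j))"
    by (simp only: sum_distrib_left mult_smult_right poly_int_sum poly_int_smult)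
  also have "\<dots> = 0"
    by (intro sum.neutral) (auto simp: legendre_orthogonal)
  finally show ?thesis .
qed

section \<open>Bounds and norms of the Legendre polynomials\<close>

text \<open>The function \<open>L q\<^sup>2 + (1 - x\<^sup>2) q'\<^sup>2\<close> is increasing for positive \<open>x\<close>.\<close>

lemma legendre_eigenfunction_le:
  assumes q: "legendre_op q = smult (- L) q" and L: "L > 0" and x: "0 \<le> x" "x \<le> 1"
  shows "(poly q x)\<^sup>2 \<le> (poly q 1)\<^sup>2"
proof -
  define F where "F = (\<lambda>x. L * (poly q x)\<^sup>2 + (1 - x\<^sup>2) * (poly (pderiv q) x)\<^sup>2)"
  have "(F has_real_derivative 2 * y * (poly (pderiv q) y)\<^sup>2) (at y)" for y
  proof -
    have "(F has_real_derivative 2 * L * poly q y * poly (pderiv q) y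
        + (- 2 * y * (poly (pderiv q) y)\<^sup>2
           + 2 * poly (pderiv q) y * ((1 - y\<^sup>2) * poly (pderiv (pderiv q)) y))) (at y)"
      unfolding F_def
      by (auto intro!: derivative_eq_intros poly_DERIV simp: algebra_simps)
    moreover have "(1 - y\<^sup>2) * poly (pderiv (pderiv q)) y = 2 * y * poly (pderiv q) y - L * poly q y"
      using arg_cong[OF q, of "\<lambda>p. poly p y"] by (simp add: poly_legendre_op)
    ultimately show ?thesis
      by (simp only:) (simp add: algebra_simps power2_eq_square)
  qed
  then have "F x \<le> F 1"
    using x by (intro DERIV_nonneg_imp_nondecreasing[OF x(2)]) (auto intro!: exI)
  moreover have "x\<^sup>2 \<le> 1"
    using x by (simp add: power_le_one)
  then have "L * (poly q x)\<^sup>2 \<le> F x"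
    by (simp add: F_def)
  ultimately have "L * (poly q x)\<^sup>2 \<le> L * (poly q 1)\<^sup>2"
    by (simp add: F_def)
  then show ?thesis using L by simp
qed

text \<open>The weight 1 - x^2 is even. The reflection carries estimates from [0,1] over to
  [-1,0].\<close>

lemma legendre_op_reflect: "legendre_op (pcompose p [:0, -1:]) = pcompose (legendre_op p) [:0, -1:]"
proof -
  have "poly (legendre_op (pcompose p [:0, -1:])) x = poly (pcompose (legendre_op p) [:0, -1:]) x" for x
    by (simp add: poly_legendre_op pderiv_pcompose poly_pcompose pderiv_pCons pderiv_minus)
  then show ?thesis
    by (simp add: poly_eq_poly_eq_iff[symmetric] fun_eq_iff)
qed

text \<open>The value at 1 controls q on [0,1], so q has infinitely many zeros there. Consequently
  an eigenfunction is determined by its value at 1.\<close>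

lemma legendre_eigenfunction_eq_0:
  assumes q: "legendre_op q = smult (- L) q" and L: "L > 0" and "poly q 1 = 0"
  shows "q = 0"
proof (rule ccontr)
  assume "q \<noteq> 0"
  then have "finite {x. poly q x = 0}"
    by (rule poly_roots_finite)
  moreover have "{0..1} \<subseteq> {x. poly q x = 0}"
    using legendre_eigenfunction_le[OF q L] assms(3) by auto
  ultimately have "finite {0..1::real}"
    by (rule rev_finite_subset)
  moreover have "infinite {0..1::real}"
    by (rule infinite_Icc) simp
  ultimately show False by simp
qed

lemma legendre_0: "legendre 0 = 1"
  by (simp add: legendre_def legendre_coeff_def)

text \<open>P(-x) solves the same eigenvalue equation as P, hence equals c P(x) with c = P(-1); at x
  = -1 this reads 1 = c^2. The case l = 0 stands apart because the uniqueness argument requires a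
  positive eigenvalue.\<close>

lemma poly_legendre_minus_1: "(poly (legendre l) (-1))\<^sup>2 = 1"
proof (cases "l = 0")
  case False
  define c where "c = poly (legendre l) (-1)"
  define q where "q = pcompose (legendre l) [:0, -1:] - smult c (legendre l)"
  have "legendre_op q = smult (- (real l * (real l + 1))) q"
    by (simp only: q_def legendre_op_diff legendre_op_reflect legendre_op_smult legendre_op_legendre
        pcompose_smult smult_diff_right smult_smult mult.commute)
  moreover have "poly q 1 = 0"
    by (simp add: q_def c_def poly_pcompose poly_legendre_1)
  ultimately have "q = 0"
    using False by (intro legendre_eigenfunction_eq_0[of q "real l * (real l + 1)"]) auto
  then have "poly q (-1) = 0" by simp
  then show ?thesis
    by (simp add: q_def c_def[symmetric] poly_pcompose poly_legendre_1 power2_eq_square)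
qed (simp add: legendre_0)

lemma abs_poly_legendre_le:
  assumes "x \<in> {-1..1}"
  shows "\<bar>poly (legendre l) x\<bar> \<le> 1"
proof (cases "l = 0")
  case False
  then have L: "real l * (real l + 1) > 0" by simp
  have "(poly (legendre l) x)\<^sup>2 \<le> 1"
  proof (cases "x \<ge> 0")
    case True
    with legendre_eigenfunction_le[OF legendre_op_legendre L, of x] assms show ?thesis
      by (simp add: poly_legendre_1)
  next
    case False
    have "legendre_op (pcompose (legendre l) [:0, -1:])
        = smult (- (real l * (real l + 1))) (pcompose (legendre l) [:0, -1:])"
      by (simp only: legendre_op_reflect legendre_op_legendre pcompose_smult)
    from legendre_eigenfunction_le[OF this L, of "- x"] False assms show ?thesis
      by (simp add: poly_pcompose poly_legendre_minus_1)
  qed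
  then show ?thesis by (simp add: abs_square_le_1)
qed (simp add: legendre_0)

text \<open>In d = x P' - l P the terms of degree l cancel, so d is orthogonal to P. Integrating (x
  P^2)' = (2l+1) P^2 + 2 P d leaves boundary values only, and these add up to 2 since P(1)^2 =
  P(-1)^2 = 1.\<close>

lemma poly_int_legendre_square: "poly_int (legendre l * legendre l) = 2 / (2 * real l + 1)"
proof -
  define P where "P = legendre l"
  define d where "d = pCons 0 (pderiv P) - smult (real l) P"
  have deg: "degree (pCons 0 (pderiv P)) \<le> l"
  proof (cases "pderiv P = 0")
    case False
    then have "degree P \<noteq> 0" by (auto simp: pderiv_eq_0_iff)
    then show ?thesis
      using degree_legendre_le[of l] False by (simp add: P_def degree_pderiv)
  qed simp
  have P: "poly_int (P * d) = 0"
  proof (cases "d = 0")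
    case False
    have "degree d \<le> l"
      unfolding d_def using deg degree_legendre_le[of l]
      by (intro degree_diff_le order.trans[OF degree_smult_le]) (auto simp: P_def)
    moreover have "coeff d l = 0"
      by (cases l) (simp_all add: d_def coeff_pderiv)
    ultimately have "degree d < l"
      using False by (metis le_neq_implies_less leading_coeff_0_iff)
    then show ?thesis
      unfolding P_def by (rule legendre_orthogonal_lower)
  qed (simp add: poly_int_0)
  have "pderiv (pCons 0 (P * P)) = P * P + smult 2 (P * pCons 0 (pderiv P))"
    using smult_add_left[of 1 1 "P * pCons 0 (pderiv P)"]
    by (simp add: pderiv_pCons pderiv_mult mult.commute)
  also have "pCons 0 (pderiv P) = d + smult (real l) P"
    by (simp add: d_def)
  also have "P * P + smult 2 (P * (d + smult (real l) P)) = smult (2 * real l + 1) (P * P) + smult 2 (P * d)"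
    by (simp add: algebra_simps smult_add_left smult_add_right)
  finally have "(2 * real l + 1) * poly_int (P * P)
      = poly (pCons 0 (P * P)) 1 - poly (pCons 0 (P * P)) (-1)"
    using P by (simp only: poly_int_pderiv[symmetric] poly_int_add poly_int_smult)
  also have "\<dots> = 2"
    using poly_legendre_minus_1[of l] by (simp add: P_def poly_legendre_1 power2_eq_square)
  finally show ?thesis
    by (simp add: P_def field_simps)
qed

text \<open>Because |P_l| <= 1, the Legendre coefficients of a nonnegative kernel are controlled by
  its mass alone, however concentrated it is.\<close>

lemma poly_int_mult_legendre_le:
  assumes "\<And>x. x \<in> {-1..1} \<Longrightarrow> poly k x \<ge> 0"
  shows "\<bar>poly_int (k * legendre l)\<bar> \<le> poly_int k"
proof (rule abs_leI)
  have *: "\<bar>poly k x * poly (legendre l) x\<bar> \<le> poly k x" if "x \<in> {-1..1}" for x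
    using mult_left_mono[OF abs_poly_legendre_le[OF that] assms[OF that]] assms[OF that]
    by (simp add: abs_mult)
  show "poly_int (k * legendre l) \<le> poly_int k"
    by (rule poly_int_mono) (use * in \<open>force simp: abs_le_iff\<close>)
  have "poly_int (- (k * legendre l)) \<le> poly_int k"
    by (rule poly_int_mono) (use * in \<open>force simp: abs_le_iff\<close>)
  then show "- poly_int (k * legendre l) \<le> poly_int k"
    by (simp only: poly_int_minus)
qed

section \<open>The eigenvalue sum and the polynomial Green function\<close>

text \<open>With \<open>X = M + l(l + 1)\<close>, the term \<open>(2l + 1) / X\<^sup>2\<close> is at most
  \<open>(2l + 1) / (X\<^sup>2 - M - 2 l (l + 1))\<close>, which is the difference of \<open>1 / (M + l\<^sup>2 - 1)\<close> and its successor.\<close>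

lemma sum_eigenvalues_le:
  fixes M :: real
  assumes "M > 0"
  shows "(\<Sum>l=1..<n. (2 * real l + 1) / (M + real l * (real l + 1))\<^sup>2) \<le> 1 / M"
proof -
  define g where "g = (\<lambda>l. 1 / (M + (real l)\<^sup>2 - 1))"
  have tele: "(2 * real l + 1) / (M + real l * (real l + 1))\<^sup>2 \<le> g l - g (Suc l)" if "l \<ge> 1" for l
  proof -
    have l: "(real l)\<^sup>2 \<ge> 1" using that by (simp add: one_le_power)
    define a where "a = M + (real l)\<^sup>2 - 1"
    define b where "b = M + (real (Suc l))\<^sup>2 - 1"
    have ab: "a > 0" "b - a = 2 * real l + 1"
      using l assms by (simp_all add: a_def b_def power2_eq_square algebra_simps)
    have b: "b > 0" using ab by linarith
    have "(M + real l * (real l + 1))\<^sup>2 - a * b = M + 2 * real l * (real l + 1)"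
      by (simp add: a_def b_def power2_eq_square algebra_simps)
    then have "a * b \<le> (M + real l * (real l + 1))\<^sup>2"
      using assms by (smt (verit) mult_nonneg_nonneg of_nat_0_le_iff)
    then have "(2 * real l + 1) / (M + real l * (real l + 1))\<^sup>2 \<le> (2 * real l + 1) / (a * b)"
      using ab b assms
      by (intro divide_left_mono) (auto intro!: mult_pos_pos zero_less_power add_pos_nonneg)
    also have "\<dots> = 1 / a - 1 / b"
      using ab b by (simp add: field_simps)
    finally show ?thesis by (simp add: g_def a_def b_def)
  qed
  have g: "g l \<ge> 0" if "l \<ge> 1" for l
  proof -
    have "(real l)\<^sup>2 \<ge> 1" using that by (simp add: one_le_power)
    then have "M + (real l)\<^sup>2 - 1 \<ge> 0" using assms by linarith
    then show ?thesis by (simp add: g_def)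
  qed
  have "(\<Sum>l=1..<n. (2 * real l + 1) / (M + real l * (real l + 1))\<^sup>2) \<le> g 1 - g n" if "n \<ge> 1"
    using that
  proof (induction n rule: dec_induct)
    case (step i)
    then show ?case using tele[of i] by simp
  qed simp
  note sum = this
  show ?thesis
  proof (cases "n \<ge> 1")
    case True
    moreover have "g 1 = 1 / M" by (simp add: g_def)
    ultimately show ?thesis
      using g[of n] sum by linarith
  qed (use assms in simp)
qed

text \<open>The coefficient a_l of k is divided by m^2 + l(l+1). Mass and positivity of k give |a_l|
  <= (2l+1)/(4 pi), so the bound on g does not depend on k and survives its concentration.\<close>

lemma green_function_polynomial:
  assumes m: "m > 0" and k: "\<And>x. x \<in> {-1..1} \<Longrightarrow> poly k x \<ge> 0" and k1: "poly_int k = 1 / (2 * pi)"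
  obtains g where "poly_int g = 0" "smult (m\<^sup>2) g - legendre_op g = k - [:1 / (4 * pi):]"
    "poly_int (g * g) \<le> 1 / (8 * pi\<^sup>2 * m\<^sup>2)"
proof -
  define N where "N = Suc (degree k)"
  obtain a where a: "k = (\<Sum>l<N. smult (a l) (legendre l))"
    using poly_eq_sum_legendre[of k N] by (auto simp: N_def)
  have a_int: "poly_int (k * legendre j) = a j * (2 / (2 * real j + 1))" if "j < N" for j
  proof -
    have "poly_int (k * legendre j) = (\<Sum>l<N. a l * poly_int (legendre l * legendre j))"
      unfolding a by (simp only: sum_distrib_right mult_smult_left poly_int_sum poly_int_smult)
    also have "\<dots> = a j * poly_int (legendre j * legendre j)"
      using that by (subst sum.remove[of _ j]) (auto intro!: sum.neutral simp: legendre_orthogonal)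
    finally show ?thesis by (simp only: poly_int_legendre_square)
  qed
  define \<mu> where "\<mu> = (\<lambda>l. m\<^sup>2 + real l * (real l + 1))"
  have \<mu>: "\<mu> l > 0" for l using m by (simp add: \<mu>_def add_pos_nonneg)
  \<comment> \<open>The sum starts at 1: the omitted component l = 0 is the constant a_0 = 1/(4 pi)
    that is subtracted from k, and without it the eigenvalue sum stays below 1/m^2.\<close>
  define g where "g = (\<Sum>l=1..<N. smult (a l / \<mu> l) (legendre l))"
  have split: "{..<N} = insert 0 {1..<N}" by (auto simp: N_def)
  show thesis
  proof
    have "poly_int (legendre l) = 0" if "l \<ge> 1" for l
      using legendre_orthogonal[of l 0] that by (simp add: legendre_0)
    then show "poly_int g = 0"
      by (simp only: g_def poly_int_sum poly_int_smult) (auto intro!: sum.neutral)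
    have eq: "m\<^sup>2 * c - c * (- e) = c * (m\<^sup>2 + e)" for c e :: real
      by (simp add: algebra_simps)
    have "smult (m\<^sup>2) g - legendre_op g = (\<Sum>l=1..<N. smult (a l / \<mu> l * \<mu> l) (legendre l))"
      unfolding g_def legendre_op_sum smult_sum_right sum_subtractf[symmetric]
      by (intro sum.cong refl)
         (simp only: legendre_op_smult legendre_op_legendre smult_smult smult_diff_left[symmetric] eq \<mu>_def)
    also have "\<dots> = (\<Sum>l=1..<N. smult (a l) (legendre l))"
      using \<mu> by (intro sum.cong refl) (simp add: less_imp_neq[THEN not_sym])
    also have "\<dots> = k - smult (a 0) 1"
      by (subst a) (simp add: split legendre_0)
    also have "a 0 = 1 / (4 * pi)"
      using a_int[of 0] by (simp add: N_def legendre_0 k1)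
    finally show "smult (m\<^sup>2) g - legendre_op g = k - [:1 / (4 * pi):]"
      by (simp add: one_pCons)
    have a_le: "(a l)\<^sup>2 \<le> ((2 * real l + 1) / (4 * pi))\<^sup>2" if "l < N" for l
    proof -
      have "\<bar>a l\<bar> * (2 / (2 * real l + 1)) \<le> 1 / (2 * pi)"
        using poly_int_mult_legendre_le[OF k, of l] by (simp add: a_int[OF that] k1 abs_mult)
      then have "\<bar>a l\<bar> \<le> (2 * real l + 1) / (4 * pi)"
        by (simp add: field_simps)
      from power_mono[OF this, of 2] show ?thesis by simp
    qed
    have "poly_int (g * g)
        = (\<Sum>i=1..<N. \<Sum>j=1..<N. a i / \<mu> i * (a j / \<mu> j * poly_int (legendre j * legendre i)))"
      unfolding g_def
      by (simp only: sum_distrib_left sum_distrib_right mult_smult_left mult_smult_right poly_int_sum poly_int_smult)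
    also have "\<dots> = (\<Sum>i=1..<N. a i / \<mu> i * (a i / \<mu> i * poly_int (legendre i * legendre i)))"
    proof (intro sum.cong refl)
      fix i assume "i \<in> {1..<N}"
      then show "(\<Sum>j=1..<N. a i / \<mu> i * (a j / \<mu> j * poly_int (legendre j * legendre i)))
          = a i / \<mu> i * (a i / \<mu> i * poly_int (legendre i * legendre i))"
        by (subst sum.remove[of _ i]) (auto intro!: sum.neutral simp: legendre_orthogonal)
    qed
    also have "\<dots> = (\<Sum>l=1..<N. (a l)\<^sup>2 * (2 / ((2 * real l + 1) * (\<mu> l)\<^sup>2)))"
      unfolding poly_int_legendre_square by (simp add: power2_eq_square mult_ac)
    also have "\<dots> \<le> (\<Sum>l=1..<N. ((2 * real l + 1) / (4 * pi))\<^sup>2 * (2 / ((2 * real l + 1) * (\<mu> l)\<^sup>2)))"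
      using a_le by (intro sum_mono mult_right_mono) auto
    also have "\<dots> = 1 / (8 * pi\<^sup>2) * (\<Sum>l=1..<N. (2 * real l + 1) / (\<mu> l)\<^sup>2)"
    proof -
      have "(c / (4 * pi))\<^sup>2 * (2 / (c * d)) = 1 / (8 * pi\<^sup>2) * (c / d)" if "c > 0" for c d :: real
        using that by (simp add: power2_eq_square field_simps)
      then show ?thesis
        unfolding sum_distrib_left by (intro sum.cong refl) simp
    qed
    also have "\<dots> \<le> 1 / (8 * pi\<^sup>2) * (1 / m\<^sup>2)"
      unfolding \<mu>_def using m by (intro mult_left_mono sum_eigenvalues_le) auto
    finally show "poly_int (g * g) \<le> 1 / (8 * pi\<^sup>2 * m\<^sup>2)" by simp
  qed
qed

section \<open>Green's formula for zonal functions on the sphere\<close>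

text \<open>Each summand is integrated first in the variable of its own derivative, where the
  fundamental theorem gives a difference of equal boundary values; for \<open>Fd\<close> this
  requires swapping the order of integration.\<close>

lemma integral_divergence_rectangle:
  fixes F H Fd Hd :: "real \<Rightarrow> real \<Rightarrow> real"
  assumes F: "\<And>x y. ((\<lambda>x. F x y) has_real_derivative Fd x y) (at x)"
    and H: "\<And>x y. ((\<lambda>y. H x y) has_real_derivative Hd x y) (at y)"
    and cont: "continuous_on UNIV (\<lambda>(x, y). Fd x y)" "continuous_on UNIV (\<lambda>(x, y). Hd x y)"
    and bd: "\<And>y. F a y = F b y" "\<And>x. H x c = H x d" and ab: "a \<le> b" "c \<le> d"
  shows "integral (cbox (a, c) (b, d)) (\<lambda>(x, y). Fd x y + Hd x y) = 0"
proof -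
  have int: "(\<lambda>(x, y). G x y) integrable_on cbox (a, c) (b, d)"
    if "continuous_on UNIV (\<lambda>(x, y). G x y)" for G :: "real \<Rightarrow> real \<Rightarrow> real"
    using that by (intro integrable_continuous continuous_on_subset[OF that]) auto
  have "integral (cbox (a, c) (b, d)) (\<lambda>(x, y). Fd x y + Hd x y)
      = integral (cbox (a, c) (b, d)) (\<lambda>(x, y). Fd x y) + integral (cbox (a, c) (b, d)) (\<lambda>(x, y). Hd x y)"
    using integral_add[OF int[OF cont(1)] int[OF cont(2)]] by (simp add: case_prod_unfold)
  also have "integral (cbox (a, c) (b, d)) (\<lambda>(x, y). Hd x y)
      = integral (cbox a b) (\<lambda>x. integral (cbox c d) (\<lambda>y. Hd x y))"
    using integral_prod_continuous[OF continuous_on_subset[OF cont(2)]] by simp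
  also have "\<dots> = 0"
  proof -
    have "(Hd x has_integral H x d - H x c) (cbox c d)" for x
      unfolding box_real using ab(2)
      by (rule fundamental_theorem_of_calculus)
         (auto simp flip: has_real_derivative_iff_has_vector_derivative intro: DERIV_subset[OF H])
    then have "integral (cbox c d) (Hd x) = 0" for x by (simp add: bd integral_unique)
    then show ?thesis by simp
  qed
  also have "integral (cbox (a, c) (b, d)) (\<lambda>(x, y). Fd x y)
      = integral (cbox a b) (\<lambda>x. integral (cbox c d) (\<lambda>y. Fd x y))"
    using integral_prod_continuous[OF continuous_on_subset[OF cont(1)]] by simp
  also have "\<dots> = integral (cbox c d) (\<lambda>y. integral (cbox a b) (\<lambda>x. Fd x y))"
    by (rule integral_swap_continuous[OF continuous_on_subset[OF cont(1)]]) simp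
  also have "\<dots> = 0"
  proof -
    have "((\<lambda>x. Fd x y) has_integral F b y - F a y) (cbox a b)" for y
      unfolding box_real using ab(1)
      by (rule fundamental_theorem_of_calculus)
         (auto simp flip: has_real_derivative_iff_has_vector_derivative intro: DERIV_subset[OF F])
    then have "integral (cbox a b) (\<lambda>x. Fd x y) = 0" for y by (simp add: bd integral_unique)
    then show ?thesis by simp
  qed
  finally show ?thesis by simp
qed

section \<open>Integrals over the sphere\<close>

lemma borel_measurable_area_S2 [measurable_dest]:
  "f \<in> borel_measurable borel \<Longrightarrow> f \<in> borel_measurable area_S2"
  by (simp add: measurable_cong_sets[OF sets_area_S2 refl] measurable_restrict_space1)

lemma finite_measure_area_S2: "finite_measure area_S2"
  by (rule finite_measureI) (simp add: emeasure_area_S2)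

interpretation area_S2: finite_measure area_S2
  by (rule finite_measure_area_S2)

lemma measure_area_S2: "measure area_S2 S2 = 4 * pi"
  by (simp add: measure_def emeasure_area_S2)

lemma integrable_area_S2_bounded:
  fixes f :: "real^3 \<Rightarrow> 'a::{banach, second_countable_topology}"
  assumes "f \<in> borel_measurable area_S2" "\<And>s. s \<in> S2 \<Longrightarrow> norm (f s) \<le> B"
  shows "integrable area_S2 f"
  using assms by (intro area_S2.integrable_const_bound[where B = B]) auto

lemma compact_S2: "compact S2"
  by (simp add: S2_def)

lemma continuous_on_spherical_coords: "continuous_on A spherical_coords"
proof (subst continuous_on_componentwise, rule ballI)
  fix b :: "real^3" assume "b \<in> Basis"
  then obtain i where b: "b = axis i 1" by (auto simp: Basis_vec_def)
  consider "i = 1" | "i = 2" | "i = 3" using exhaust_3 by blast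
  then show "continuous_on A (\<lambda>x. spherical_coords x \<bullet> b)"
    by cases (simp_all add: b inner_axis spherical_coords_def case_prod_unfold continuous_intros)
qed

lemma inner_spherical_coords:
  "r \<bullet> spherical_coords (\<theta>, \<phi>) = sin \<theta> * (r $ 1 * cos \<phi> + r $ 2 * sin \<phi>) + r $ 3 * cos \<theta>"
  by (simp add: spherical_coords_def inner_vec_def sum_3 algebra_simps)

lemma integral_area_S2:
  fixes f :: "real^3 \<Rightarrow> real"
  assumes f: "continuous_on UNIV f"
  shows "(LINT s|area_S2. f s)
    = integral (cbox (0, 0) (pi, 2 * pi)) (\<lambda>(\<theta>, \<phi>). sin \<theta> * f (spherical_coords (\<theta>, \<phi>)))"
proof -
  let ?B = "cbox (0, 0) (pi, 2 * pi) :: (real \<times> real) set"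
  define w where "w = (\<lambda>p :: real \<times> real. sin (fst p) * indicator ?B p)"
  have B: "?B = {0..pi} \<times> {0..2*pi}"
    by (simp add: cbox_Pair_eq)
  have w_nonneg: "w p \<ge> 0" for p
    by (auto simp: w_def B indicator_def intro!: sin_ge_zero split: prod.splits)
  have w_meas [measurable]: "w \<in> borel_measurable borel"
    unfolding w_def by (intro borel_measurable_times borel_measurable_continuous_onI borel_measurable_indicator)
      (auto intro!: continuous_intros)
  have [measurable]: "f \<in> borel_measurable borel"
    using f by (rule borel_measurable_continuous_onI)
  have "(\<lambda>(\<theta>, \<phi>). ennreal (sin \<theta>) * indicator ({0..pi} \<times> {0..2*pi}) (\<theta>, \<phi>)) = (\<lambda>p. ennreal (w p))"
    unfolding w_def B by (auto simp: fun_eq_iff indicator_def)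
  then have area: "area_S2 = distr (density lborel (\<lambda>p. ennreal (w p))) (restrict_space borel S2) spherical_coords"
    by (simp add: area_S2_def)
  have [measurable]: "spherical_coords \<in> borel \<rightarrow>\<^sub>M borel"
    by (intro borel_measurable_continuous_onI continuous_on_spherical_coords)
  have "(LINT s|area_S2. f s) = (LINT p|density lborel (\<lambda>p. ennreal (w p)). f (spherical_coords p))"
    unfolding area
    by (rule integral_distr) (use spherical_coords_measurable in \<open>simp_all add: measurable_restrict_space1\<close>)
  also have "\<dots> = (LINT p|lborel. w p *\<^sub>R f (spherical_coords p))"
    by (rule integral_density) (auto simp: w_nonneg)
  also have "\<dots> = (LINT p:?B|lborel. sin (fst p) * f (spherical_coords p))"
    unfolding set_lebesgue_integral_def
    by (intro Bochner_Integration.integral_cong) (auto simp: w_def indicator_def)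
  also have "\<dots> = integral ?B (\<lambda>p. sin (fst p) * f (spherical_coords p))"
  proof (rule set_borel_integral_eq_integral)
    show "set_integrable lborel ?B (\<lambda>p. sin (fst p) * f (spherical_coords p))"
      unfolding set_integrable_def
      by (rule borel_integrable_compact)
         (auto intro!: continuous_intros continuous_on_compose2[OF f] continuous_on_spherical_coords)
  qed
  finally show ?thesis by (simp add: case_prod_unfold)
qed

text \<open>The integrand is the surface divergence of a(r \<bullet> t) times the gradient of b(s
  \<bullet> t). Multiplied by sin \<theta> it is the plane divergence of (F, H) in coordinates. F
  vanishes at the poles through its factor sin \<theta>, and H is periodic in \<phi>, so no boundary
  terms remain.\<close>

lemma integral_area_S2_Green:
  assumes s: "s \<in> S2"
  shows "(LINT t|area_S2. poly a (r \<bullet> t) * poly (legendre_op b) (s \<bullet> t)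
      + poly (pderiv a) (r \<bullet> t) * poly (pderiv b) (s \<bullet> t) * (r \<bullet> s - (r \<bullet> t) * (s \<bullet> t))) = 0"
proof -
  \<comment> \<open>Components of v in the orthonormal frame at the point with coordinates
    (\<theta>, \<phi>): X is radial, T along the meridian, D along the circle of latitude. C is the
    component along the horizontal direction (cos \<phi>, sin \<phi>, 0).\<close>
  define C where "C = (\<lambda>(v::real^3) \<phi>. v $ 1 * cos \<phi> + v $ 2 * sin \<phi>)"
  define D where "D = (\<lambda>(v::real^3) \<phi>. v $ 2 * cos \<phi> - v $ 1 * sin \<phi>)"
  define X where "X = (\<lambda>(v::real^3) \<theta> \<phi>. sin \<theta> * C v \<phi> + v $ 3 * cos \<theta>)"
  define T where "T = (\<lambda>(v::real^3) \<theta> \<phi>. cos \<theta> * C v \<phi> - v $ 3 * sin \<theta>)"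
  have inner_X: "v \<bullet> spherical_coords (\<theta>, \<phi>) = X v \<theta> \<phi>" for v \<theta> \<phi>
    by (simp add: inner_spherical_coords X_def C_def)
  have derivs:
    "(C v has_real_derivative D v \<phi>) (at \<phi>)"
    "(D v has_real_derivative - C v \<phi>) (at \<phi>)"
    "((\<lambda>\<theta>. X v \<theta> \<phi>) has_real_derivative T v \<theta> \<phi>) (at \<theta>)"
    "(X v \<theta> has_real_derivative sin \<theta> * D v \<phi>) (at \<phi>)"
    "((\<lambda>\<theta>. T v \<theta> \<phi>) has_real_derivative - X v \<theta> \<phi>) (at \<theta>)" for v \<theta> \<phi>
    unfolding X_def T_def C_def D_def by (auto intro!: derivative_eq_intros simp: algebra_simps)
  define F where "F = (\<lambda>\<theta> \<phi>. poly a (X r \<theta> \<phi>) * poly (pderiv b) (X s \<theta> \<phi>) * (sin \<theta> * T s \<theta> \<phi>))"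
  define H where "H = (\<lambda>\<theta> \<phi>. poly a (X r \<theta> \<phi>) * poly (pderiv b) (X s \<theta> \<phi>) * D s \<phi>)"
  define Fd where "Fd = (\<lambda>\<theta> \<phi>. poly (pderiv a) (X r \<theta> \<phi>) * T r \<theta> \<phi> * poly (pderiv b) (X s \<theta> \<phi>) * (sin \<theta> * T s \<theta> \<phi>)
    + poly a (X r \<theta> \<phi>) * (poly (pderiv (pderiv b)) (X s \<theta> \<phi>) * T s \<theta> \<phi> * (sin \<theta> * T s \<theta> \<phi>)
      + poly (pderiv b) (X s \<theta> \<phi>) * (cos \<theta> * T s \<theta> \<phi> - sin \<theta> * X s \<theta> \<phi>)))"
  define Hd where "Hd = (\<lambda>\<theta> \<phi>. poly (pderiv a) (X r \<theta> \<phi>) * (sin \<theta> * D r \<phi>) * poly (pderiv b) (X s \<theta> \<phi>) * D s \<phi>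
    + poly a (X r \<theta> \<phi>) * (poly (pderiv (pderiv b)) (X s \<theta> \<phi>) * (sin \<theta> * D s \<phi>) * D s \<phi>
      - poly (pderiv b) (X s \<theta> \<phi>) * C s \<phi>))"
  have cont: "continuous_on UNIV (\<lambda>p :: real \<times> real. C v (snd p))" "continuous_on UNIV (\<lambda>p :: real \<times> real. D v (snd p))"
    "continuous_on UNIV (\<lambda>p. X v (fst p) (snd p))" "continuous_on UNIV (\<lambda>p. T v (fst p) (snd p))" for v
    unfolding X_def T_def C_def D_def by (auto intro!: continuous_intros)
  \<comment> \<open>Parseval's identity in this frame, with the radial part moved to the
    right.\<close>
  have orth: "T v \<theta> \<phi> * T u \<theta> \<phi> + D v \<phi> * D u \<phi> = v \<bullet> u - X v \<theta> \<phi> * X u \<theta> \<phi>" for u v \<theta> \<phi>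
  proof -
    have "T v \<theta> \<phi> * T u \<theta> \<phi> + X v \<theta> \<phi> * X u \<theta> \<phi>
        = ((sin \<theta>)\<^sup>2 + (cos \<theta>)\<^sup>2) * (C v \<phi> * C u \<phi> + v $ 3 * u $ 3)"
      unfolding T_def X_def by algebra
    moreover have "C v \<phi> * C u \<phi> + D v \<phi> * D u \<phi>
        = ((sin \<phi>)\<^sup>2 + (cos \<phi>)\<^sup>2) * (v $ 1 * u $ 1 + v $ 2 * u $ 2)"
      unfolding C_def D_def by algebra
    ultimately show ?thesis
      by (simp add: inner_vec_def sum_3)
  qed
  have ss: "s \<bullet> s = 1"
    using s by (simp add: S2_def dot_square_norm)
  have eq: "sin \<theta> * (poly a (X r \<theta> \<phi>) * poly (legendre_op b) (X s \<theta> \<phi>)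
      + poly (pderiv a) (X r \<theta> \<phi>) * poly (pderiv b) (X s \<theta> \<phi>) * (r \<bullet> s - X r \<theta> \<phi> * X s \<theta> \<phi>))
      = Fd \<theta> \<phi> + Hd \<theta> \<phi>" for \<theta> \<phi>
  proof -
    \<comment> \<open>The coordinate form of the fact that t -> s \<bullet> t is an eigenfunction of
      the Laplace-Beltrami operator with eigenvalue -2.\<close>
    have lap: "cos \<theta> * T s \<theta> \<phi> - sin \<theta> * X s \<theta> \<phi> - C s \<phi> = - 2 * sin \<theta> * X s \<theta> \<phi>"
      using sin_cos_squared_add[of \<theta>] unfolding T_def X_def by algebra
    have rs: "r \<bullet> s - X r \<theta> \<phi> * X s \<theta> \<phi> = T r \<theta> \<phi> * T s \<theta> \<phi> + D r \<phi> * D s \<phi>"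
      by (simp only: orth)
    have ss': "1 - (X s \<theta> \<phi>)\<^sup>2 = T s \<theta> \<phi> * T s \<theta> \<phi> + D s \<phi> * D s \<phi>"
      by (simp add: orth ss power2_eq_square)
    show ?thesis
      unfolding Fd_def Hd_def rs poly_legendre_op ss' using lap by algebra
  qed
  have "(LINT t|area_S2. poly a (r \<bullet> t) * poly (legendre_op b) (s \<bullet> t)
      + poly (pderiv a) (r \<bullet> t) * poly (pderiv b) (s \<bullet> t) * (r \<bullet> s - (r \<bullet> t) * (s \<bullet> t)))
    = integral (cbox (0, 0) (pi, 2 * pi)) (\<lambda>(\<theta>, \<phi>). Fd \<theta> \<phi> + Hd \<theta> \<phi>)"
    by (subst integral_area_S2) (auto intro!: continuous_intros simp: inner_X eq)
  also have "\<dots> = 0"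
  proof (rule integral_divergence_rectangle[where F = F and H = H])
    show "((\<lambda>\<theta>. F \<theta> \<phi>) has_real_derivative Fd \<theta> \<phi>) (at \<theta>)" for \<theta> \<phi>
      unfolding F_def Fd_def
      by (auto intro!: derivative_eq_intros derivs DERIV_chain2[OF poly_DERIV] simp: algebra_simps)
    show "((\<lambda>\<phi>. H \<theta> \<phi>) has_real_derivative Hd \<theta> \<phi>) (at \<phi>)" for \<theta> \<phi>
      unfolding H_def Hd_def
      by (auto intro!: derivative_eq_intros derivs DERIV_chain2[OF poly_DERIV] simp: algebra_simps)
    show "continuous_on UNIV (\<lambda>(\<theta>, \<phi>). Fd \<theta> \<phi>)" "continuous_on UNIV (\<lambda>(\<theta>, \<phi>). Hd \<theta> \<phi>)"
      unfolding Fd_def Hd_def case_prod_unfold by (intro continuous_intros cont)+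
    show "F 0 \<phi> = F pi \<phi>" "H \<theta> 0 = H \<theta> (2 * pi)" for \<theta> \<phi>
      by (simp_all add: F_def H_def X_def C_def D_def)
  qed simp_all
  finally show ?thesis .
qed

lemma integrable_area_S2_continuous:
  fixes f :: "real^3 \<Rightarrow> 'a::euclidean_space"
  assumes "continuous_on UNIV f"
  shows "integrable area_S2 f"
proof -
  have "bounded (f ` S2)"
    by (intro compact_imp_bounded compact_continuous_image continuous_on_subset[OF assms] compact_S2) auto
  then obtain B where "\<And>s. s \<in> S2 \<Longrightarrow> norm (f s) \<le> B"
    by (auto simp: bounded_iff)
  then show ?thesis
    by (intro integrable_area_S2_bounded) (auto intro!: borel_measurable_area_S2 borel_measurable_continuous_onI assms)
qed

text \<open>The area is defined by coordinates with a fixed axis, so invariance under rotations is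
  not evident. Instead, both sides vanish on the image of \<open>legendre_op\<close>: on the left by
  Green's formula with a = 1, on the right by integration by parts. Applied to x^k this yields one
  recursion for both sides, starting from the total area at k = 0.\<close>

lemma integral_area_S2_zonal:
  assumes s: "s \<in> S2"
  shows "(LINT t|area_S2. poly p (s \<bullet> t)) = 2 * pi * poly_int p"
proof -
  have int: "integrable area_S2 (\<lambda>t. poly q (s \<bullet> t))" for q
    by (intro integrable_area_S2_continuous continuous_intros)
  have L: "(LINT t|area_S2. poly (legendre_op q) (s \<bullet> t)) = 0" for q
    using integral_area_S2_Green[OF s, of 1 s q] by simp
  have IL: "poly_int (legendre_op q) = 0" for q
    using poly_int_legendre_op_mult[of 1 q] by (simp add: poly_int_0)
  define Z where "Z = (\<lambda>q. (LINT t|area_S2. poly q (s \<bullet> t)))"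
  have Z_smult: "Z (smult c q) = c * Z q" for c q by (simp add: Z_def)
  have L_Z: "Z (legendre_op q) = 0" for q by (simp add: Z_def L)
  have Z_add: "Z (p + q) = Z p + Z q" for p q by (simp add: Z_def int Bochner_Integration.integral_add)
  have Z_sum: "Z (\<Sum>i\<in>A. f i) = (\<Sum>i\<in>A. Z (f i))" for f :: "nat \<Rightarrow> real poly" and A
    by (induction A rule: infinite_finite_induct) (simp_all add: Z_add, simp_all add: Z_def)
  have "Z (monom 1 k) = 2 * pi * poly_int (monom 1 k)" for k
  proof (induction k rule: less_induct)
    case (less k)
    show ?case
    proof (cases "k = 0")
      case True
      have "poly_int (pderiv [:0, 1:]) = 2" by (simp only: poly_int_pderiv) simp
      then show ?thesis
        using True by (simp add: Z_def measure_area_S2 pderiv_pCons flip: one_pCons)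
    next
      case False
      \<comment> \<open>For k = 1 the exponent k - 2 truncates to 0, but its coefficient k(k-1)
        vanishes.\<close>
      have op: "legendre_op (monom 1 k) = smult (- (real k * (real k + 1))) (monom 1 k)
          + smult (real k * (real k - 1)) (monom 1 (k - 2))"
      proof (cases "k = 1")
        case True
        then show ?thesis
          by (simp add: poly_eq_poly_eq_iff[symmetric] fun_eq_iff poly_legendre_op pderiv_monom poly_monom)
      next
        case nk: False
        define j where "j = k - 2"
        have "k = Suc (Suc j)" using False nk by (simp add: j_def)
        then show ?thesis
          by (simp add: poly_eq_poly_eq_iff[symmetric] fun_eq_iff poly_legendre_op pderiv_monom poly_monom
              algebra_simps power2_eq_square)
      qed
      have "real k * (real k + 1) * Z (monom 1 k) = real k * (real k - 1) * Z (monom 1 (k - 2))"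
        using L_Z[of "monom 1 k"] by (simp only: op Z_add Z_smult mult_minus_left)
      moreover have "real k * (real k + 1) * poly_int (monom 1 k) = real k * (real k - 1) * poly_int (monom 1 (k - 2))"
        using IL[of "monom 1 k"] by (simp only: op poly_int_add poly_int_smult mult_minus_left)
      moreover have "Z (monom 1 (k - 2)) = 2 * pi * poly_int (monom 1 (k - 2))"
        using False by (intro less.IH) auto
      ultimately have "real k * (real k + 1) * Z (monom 1 k) = real k * (real k + 1) * (2 * pi * poly_int (monom 1 k))"
        by algebra
      then show ?thesis using False by (simp add: add_nonneg_eq_0_iff)
    qed
  qed
  then have "Z (\<Sum>i\<le>degree p. smult (coeff p i) (monom 1 i)) = 2 * pi * poly_int (\<Sum>i\<le>degree p. smult (coeff p i) (monom 1 i))"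
    by (simp only: Z_sum Z_smult poly_int_sum poly_int_smult sum_distrib_left mult.left_commute)
  then show ?thesis
    by (simp add: smult_monom poly_as_sum_of_monoms Z_def)
qed

text \<open>The surface gradient of t -> g(s \<bullet> t): the ambient gradient g'(s \<bullet> t) s,
  projected onto the tangent plane at t.\<close>

definition zonal_field :: "real poly \<Rightarrow> real^3 \<Rightarrow> real^3 \<Rightarrow> real^3" where
  "zonal_field g s t = poly (pderiv g) (s \<bullet> t) *\<^sub>R (s - (s \<bullet> t) *\<^sub>R t)"

lemma tangent_zonal_field: "tangent_field (zonal_field g s)"
  by (auto simp: tangent_field_def zonal_field_def S2_def inner_diff_left norm_eq_1)

definition zonal_field_deriv :: "real poly \<Rightarrow> real^3 \<Rightarrow> real^3 \<Rightarrow> real^3 \<Rightarrow> real^3" where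
  "zonal_field_deriv g s t v = (poly (pderiv (pderiv g)) (s \<bullet> t) * (s \<bullet> v)) *\<^sub>R (s - (s \<bullet> t) *\<^sub>R t)
     - poly (pderiv g) (s \<bullet> t) *\<^sub>R ((s \<bullet> v) *\<^sub>R t + (s \<bullet> t) *\<^sub>R v)"

lemma has_derivative_zonal_field:
  "(zonal_field g s has_derivative zonal_field_deriv g s t) (at t within A)"
proof -
  have "((\<lambda>t. poly (pderiv g) (s \<bullet> t)) has_derivative (\<lambda>v. poly (pderiv (pderiv g)) (s \<bullet> t) * (s \<bullet> v))) (at t within A)"
    using has_derivative_compose[OF has_derivative_inner_right[OF has_derivative_ident]
      poly_DERIV[unfolded has_field_derivative_def]] .
  moreover have "((\<lambda>t. s - (s \<bullet> t) *\<^sub>R t) has_derivative (\<lambda>v. - ((s \<bullet> t) *\<^sub>R v + (s \<bullet> v) *\<^sub>R t))) (at t within A)"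
    by (rule has_derivative_eq_rhs,
        rule has_derivative_diff[OF has_derivative_const
          has_derivative_scaleR[OF has_derivative_inner_right[OF has_derivative_ident] has_derivative_ident]])
      simp
  ultimately show ?thesis
    unfolding zonal_field_def[abs_def] zonal_field_deriv_def[abs_def]
    by (rule has_derivative_eq_rhs[OF has_derivative_scaleR])
       (simp add: fun_eq_iff scaleR_add_right scaleR_diff_right add.commute)
qed

lemma C1_zonal_field: "C1_field (zonal_field g s)"
  unfolding C1_field_def
proof (intro exI[of _ "\<lambda>t. Blinfun (zonal_field_deriv g s t)"] conjI ballI)
  have D: "blinfun_apply (Blinfun (zonal_field_deriv g s t)) = zonal_field_deriv g s t" for t
    by (intro bounded_linear_Blinfun_apply has_derivative_bounded_linear[OF has_derivative_zonal_field])
  show "(zonal_field g s has_derivative blinfun_apply (Blinfun (zonal_field_deriv g s t))) (at t within S2)" for t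
    unfolding D by (rule has_derivative_zonal_field)
  show "continuous_on S2 (\<lambda>t. Blinfun (zonal_field_deriv g s t))"
    by (intro continuous_on_blinfun_componentwise)
       (auto simp: D zonal_field_deriv_def intro!: continuous_intros)
qed

text \<open>The divergence of the gradient is the Laplace-Beltrami operator. With w the tangential
  part of s, the term (1 - x^2) g'' comes from w \<bullet> w, and -2 x g' from the trace 3 - 1 of
  the tangential projection.\<close>

lemma surface_div_zonal_field:
  assumes s: "s \<in> S2" and t: "t \<in> S2"
  shows "surface_div (zonal_field g s) t = poly (legendre_op g) (s \<bullet> t)"
proof -
  define x where "x = s \<bullet> t"
  define w where "w = s - x *\<^sub>R t"
  have ss: "s \<bullet> s = 1" and tt: "t \<bullet> t = 1"
    using s t by (simp_all add: S2_def dot_square_norm)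
  have wt: "w \<bullet> t = 0" and ww: "w \<bullet> w = 1 - x\<^sup>2"
    by (simp_all add: w_def x_def ss tt inner_diff_left inner_diff_right inner_commute power2_eq_square)
  have sum_Basis: "(\<Sum>b\<in>Basis. (u \<bullet> b) * (v \<bullet> b)) = u \<bullet> v" for u v :: "real^3"
    by (rule euclidean_inner[symmetric])
  have "zonal_field_deriv g s t (b - (b \<bullet> t) *\<^sub>R t) \<bullet> b
      = poly (pderiv (pderiv g)) x * ((w \<bullet> b) * (w \<bullet> b))
        - poly (pderiv g) x * ((w \<bullet> b) * (t \<bullet> b) + x * (b \<bullet> b - (t \<bullet> b) * (t \<bullet> b)))" for b
  proof -
    define v where "v = b - (b \<bullet> t) *\<^sub>R t"
    have "s \<bullet> v = w \<bullet> b" "v \<bullet> b = b \<bullet> b - (t \<bullet> b) * (t \<bullet> b)"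
      by (simp_all add: v_def w_def x_def inner_diff_left inner_diff_right inner_commute)
    moreover have "zonal_field_deriv g s t v \<bullet> b = poly (pderiv (pderiv g)) x * ((s \<bullet> v) * (w \<bullet> b))
        - poly (pderiv g) x * ((s \<bullet> v) * (t \<bullet> b) + x * (v \<bullet> b))"
      by (simp add: zonal_field_deriv_def w_def x_def inner_diff_left inner_add_left mult.assoc)
    ultimately show ?thesis by (simp add: v_def)
  qed
  then have "surface_div (zonal_field g s) t
      = (\<Sum>b\<in>Basis. poly (pderiv (pderiv g)) x * ((w \<bullet> b) * (w \<bullet> b))
        - poly (pderiv g) x * ((w \<bullet> b) * (t \<bullet> b) + x * (b \<bullet> b - (t \<bullet> b) * (t \<bullet> b))))"
    by (simp add: surface_div_eq[OF has_derivative_zonal_field t])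
  also have "\<dots> = poly (pderiv (pderiv g)) x * (w \<bullet> w)
      - poly (pderiv g) x * (w \<bullet> t + x * ((\<Sum>b\<in>(Basis :: (real^3) set). b \<bullet> b) - t \<bullet> t))"
    by (simp only: sum_subtractf sum.distrib sum_distrib_left[symmetric] sum_Basis)
  also have "(\<Sum>b\<in>(Basis :: (real^3) set). b \<bullet> b) = 3"
    by (simp add: inner_same_Basis)
  finally show ?thesis
    by (simp add: wt ww tt poly_legendre_op x_def algebra_simps)
qed

text \<open>The duality that defines a weak gradient enters the proof here, and only with zonal test
  fields: all derivatives fall on the polynomial g.\<close>

lemma L2_inner_weak_gradient_zonal_field:
  assumes "has_weak_surface_gradient f G" and s: "s \<in> S2"
  shows "L2_inner G (zonal_field g s) = - (LINT t|area_S2. f t * poly (legendre_op g) (s \<bullet> t))"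
proof -
  have "L2_inner G (zonal_field g s) = - L2_inner f (surface_div (zonal_field g s))"
    using assms(1) C1_zonal_field tangent_zonal_field by (simp add: has_weak_surface_gradient_def)
  also have "L2_inner f (surface_div (zonal_field g s)) = (LINT t|area_S2. f t * poly (legendre_op g) (s \<bullet> t))"
    unfolding L2_inner_def
    by (intro Bochner_Integration.integral_cong refl) (simp add: surface_div_zonal_field[OF s])
  finally show ?thesis .
qed

lemma inner_zonal_field:
  assumes "t \<in> S2"
  shows "zonal_field a r t \<bullet> zonal_field b s t
    = poly (pderiv a) (r \<bullet> t) * poly (pderiv b) (s \<bullet> t) * (r \<bullet> s - (r \<bullet> t) * (s \<bullet> t))"
proof -
  have "t \<bullet> t = 1" using assms by (simp add: S2_def dot_square_norm)
  then show ?thesis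
    by (simp add: zonal_field_def inner_diff_left inner_diff_right inner_commute algebra_simps)
qed

section \<open>Square-integrable functions and zonal kernels\<close>

lemma id_measurable_area_S2 [measurable]: "(\<lambda>x. x) \<in> borel_measurable area_S2"
  by (intro borel_measurable_area_S2) simp

lemma poly_measurable [measurable]: "poly (p :: real poly) \<in> borel_measurable borel"
  by (intro borel_measurable_continuous_onI continuous_intros)

lemma measurable_fst_area_S2 [measurable]: "fst \<in> borel_measurable (area_S2 \<Otimes>\<^sub>M M)"
  using measurable_compose[OF measurable_fst id_measurable_area_S2] .

lemma measurable_snd_area_S2 [measurable]: "snd \<in> borel_measurable (M \<Otimes>\<^sub>M area_S2)"
  using measurable_compose[OF measurable_snd id_measurable_area_S2] .

text \<open>By Fubini this is the integral over t of the squared norm of the vector obtained by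
  integrating w(s) \<Theta>(s,t) over s. The dominating function b depends on t because the fields
  inserted later are square integrable but possibly unbounded.\<close>

lemma (in finite_measure) integral_quadratic_form_nonneg:
  fixes \<Theta> :: "'a \<Rightarrow> 'a \<Rightarrow> 'b::euclidean_space"
  assumes \<Theta> [measurable]: "(\<lambda>(s, t). \<Theta> s t) \<in> borel_measurable (M \<Otimes>\<^sub>M M)"
    and b: "integrable M (\<lambda>t. (b t)\<^sup>2)" "\<And>s t. s \<in> space M \<Longrightarrow> t \<in> space M \<Longrightarrow> norm (\<Theta> s t) \<le> b t"
    and w [measurable]: "w \<in> borel_measurable M" and C: "\<And>s. s \<in> space M \<Longrightarrow> \<bar>w s\<bar> \<le> C"
  shows "0 \<le> (LINT p|(M \<Otimes>\<^sub>M M). w (fst p) * w (snd p) * (LINT t|M. \<Theta> (fst p) t \<bullet> \<Theta> (snd p) t))"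
proof -
  interpret P: pair_sigma_finite M M ..
  interpret PP: finite_measure "M \<Otimes>\<^sub>M M"
    by (rule finite_measure_pair_measure) unfold_locales
  interpret T: pair_sigma_finite M "M \<Otimes>\<^sub>M M" ..
  let ?F = "\<lambda>t p. w (fst p) * w (snd p) * (\<Theta> (fst p) t \<bullet> \<Theta> (snd p) t)"
  have F_le: "\<bar>?F t p\<bar> \<le> C\<^sup>2 * (b t)\<^sup>2" if "t \<in> space M" "p \<in> space (M \<Otimes>\<^sub>M M)" for t p
  proof -
    have s: "fst p \<in> space M" "snd p \<in> space M"
      using that by (auto simp: space_pair_measure)
    have "\<bar>w (fst p)\<bar> * \<bar>w (snd p)\<bar> \<le> C * C"
      using C[OF s(1)] C[OF s(2)] by (intro mult_mono) auto
    moreover have "\<bar>\<Theta> (fst p) t \<bullet> \<Theta> (snd p) t\<bar> \<le> norm (\<Theta> (fst p) t) * norm (\<Theta> (snd p) t)"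
      by (rule Cauchy_Schwarz_ineq2)
    moreover have "norm (\<Theta> (fst p) t) * norm (\<Theta> (snd p) t) \<le> b t * b t"
      using b(2)[OF s(1) that(1)] b(2)[OF s(2) that(1)]
      by (intro mult_mono) (auto intro: order.trans[OF norm_ge_zero])
    ultimately show ?thesis
      unfolding abs_mult power2_eq_square using abs_ge_zero
      by (intro mult_mono[of "\<bar>w (fst p)\<bar> * \<bar>w (snd p)\<bar>" "C * C"]) auto
  qed
  have F_meas [measurable]: "(\<lambda>(t, p). ?F t p) \<in> borel_measurable (M \<Otimes>\<^sub>M (M \<Otimes>\<^sub>M M))"
    by measurable
  have "integrable (M \<Otimes>\<^sub>M (M \<Otimes>\<^sub>M M)) (\<lambda>(t, p). C\<^sup>2 * (b t)\<^sup>2)"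
  proof (rule T.Fubini_integrable)
    have [measurable]: "(\<lambda>t. (b t)\<^sup>2) \<in> borel_measurable M"
      using b(1) by (rule borel_measurable_integrable)
    show "(\<lambda>(t, p). C\<^sup>2 * (b t)\<^sup>2) \<in> borel_measurable (M \<Otimes>\<^sub>M (M \<Otimes>\<^sub>M M))"
      by measurable
    show "integrable M (\<lambda>t. LINT p|(M \<Otimes>\<^sub>M M). norm (case (t, p) of (t, p) \<Rightarrow> C\<^sup>2 * (b t)\<^sup>2))"
      using b(1) by simp
  qed simp
  then have int: "integrable (M \<Otimes>\<^sub>M (M \<Otimes>\<^sub>M M)) (\<lambda>(t, p). ?F t p)"
  proof (rule Bochner_Integration.integrable_bound[OF _ F_meas])
    show "AE x in M \<Otimes>\<^sub>M (M \<Otimes>\<^sub>M M). norm (case x of (t, p) \<Rightarrow> ?F t p) \<le> norm (case x of (t, p) \<Rightarrow> C\<^sup>2 * (b t)\<^sup>2)"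
      by (rule AE_I2) (auto simp: space_pair_measure intro!: order.trans[OF F_le])
  qed
  have "0 \<le> (LINT p|(M \<Otimes>\<^sub>M M). ?F t p)" if t: "t \<in> space M" for t
  proof -
    define u where "u = (\<lambda>s. w s *\<^sub>R \<Theta> s t)"
    have u_meas [measurable]: "u \<in> borel_measurable M"
      unfolding u_def using t by measurable
    have u_le: "norm (u s) \<le> C * b t" if "s \<in> space M" for s
      using C[OF that] b(2)[OF that t] by (auto simp: u_def intro!: mult_mono)
    have u: "integrable M u"
      by (rule integrable_const_bound[OF _ u_meas, where B = "C * b t"]) (auto intro!: u_le)
    have "integrable (M \<Otimes>\<^sub>M M) (\<lambda>p. ?F t p)"
      by (rule PP.integrable_const_bound[where B = "C\<^sup>2 * (b t)\<^sup>2"]) (use t F_le in \<open>auto intro!: AE_I2\<close>)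
    then have "integrable (M \<Otimes>\<^sub>M M) (\<lambda>p. u (fst p) \<bullet> u (snd p))"
      by (simp add: u_def mult_ac)
    then have "(LINT p|(M \<Otimes>\<^sub>M M). u (fst p) \<bullet> u (snd p)) = (LINT s|M. LINT r|M. u s \<bullet> u r)"
      using P.integral_fst'[of "\<lambda>p. u (fst p) \<bullet> u (snd p)"] by simp
    also have "\<dots> = (LINT s|M. u s) \<bullet> (LINT r|M. u r)"
      using u by simp
    also have "(LINT p|(M \<Otimes>\<^sub>M M). u (fst p) \<bullet> u (snd p)) = (LINT p|(M \<Otimes>\<^sub>M M). ?F t p)"
      by (simp add: u_def mult_ac)
    finally show ?thesis by simp
  qed
  then have "0 \<le> (LINT t|M. LINT p|(M \<Otimes>\<^sub>M M). ?F t p)"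
    by (rule Bochner_Integration.integral_nonneg)
  also have "\<dots> = (LINT p|(M \<Otimes>\<^sub>M M). LINT t|M. ?F t p)"
    using T.Fubini_integral[OF int] by simp
  finally show ?thesis by simp
qed

section \<open>Closure properties of the square-integrable functions\<close>

lemma L2_S2_measurable: "f \<in> L2_S2 \<Longrightarrow> f \<in> borel_measurable area_S2"
  by (simp add: L2_S2_def)

lemma L2_S2_integrable_norm: "f \<in> L2_S2 \<Longrightarrow> integrable area_S2 (\<lambda>s. (norm (f s))\<^sup>2)"
  by (simp add: L2_S2_def)

lemma L2_S2_bound:
  assumes "f \<in> borel_measurable area_S2" "integrable area_S2 h" "\<And>s. s \<in> S2 \<Longrightarrow> (norm (f s))\<^sup>2 \<le> h s"
  shows "f \<in> L2_S2"
proof -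
  note [measurable] = assms(1)
  have "integrable area_S2 (\<lambda>s. (norm (f s))\<^sup>2)"
    by (rule Bochner_Integration.integrable_bound[OF assms(2)]) (use assms(3) in \<open>force intro!: AE_I2\<close>)+
  with assms(1) show ?thesis by (simp add: L2_S2_def)
qed

lemma L2_S2_bounded:
  assumes "f \<in> borel_measurable area_S2" "\<And>s. s \<in> S2 \<Longrightarrow> norm (f s) \<le> B"
  shows "f \<in> L2_S2"
  using assms by (intro L2_S2_bound[where h = "\<lambda>_. B\<^sup>2"]) (auto intro: power_mono)

lemma L2_S2_continuous:
  fixes f :: "real^3 \<Rightarrow> 'a::euclidean_space"
  assumes "continuous_on UNIV f"
  shows "f \<in> L2_S2"
  by (rule L2_S2_bound[where h = "\<lambda>s. (norm (f s))\<^sup>2"])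
     (auto intro!: borel_measurable_area_S2 borel_measurable_continuous_onI assms
        integrable_area_S2_continuous continuous_intros)

lemma L2_S2_add:
  assumes "f \<in> L2_S2" "g \<in> L2_S2"
  shows "(\<lambda>s. f s + g s) \<in> L2_S2"
proof (rule L2_S2_bound[where h = "\<lambda>s. 2 * (norm (f s))\<^sup>2 + 2 * (norm (g s))\<^sup>2"])
  show "(norm (f s + g s))\<^sup>2 \<le> 2 * (norm (f s))\<^sup>2 + 2 * (norm (g s))\<^sup>2" for s
  proof -
    have "(norm (f s + g s))\<^sup>2 \<le> (norm (f s) + norm (g s))\<^sup>2"
      by (intro power_mono norm_triangle_ineq) simp
    also have "\<dots> \<le> 2 * (norm (f s))\<^sup>2 + 2 * (norm (g s))\<^sup>2"
      using sum_squares_bound[of "norm (f s)" "norm (g s)"] by (simp add: power2_sum)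
    finally show ?thesis .
  qed
qed (use L2_S2_measurable[OF assms(1)] L2_S2_measurable[OF assms(2)] in
      \<open>simp_all add: L2_S2_integrable_norm assms\<close>)

lemma L2_S2_scaleR: "f \<in> L2_S2 \<Longrightarrow> (\<lambda>s. c *\<^sub>R f s) \<in> L2_S2"
  by (auto simp: L2_S2_def power_mult_distrib)

lemma L2_S2_diff: "f \<in> L2_S2 \<Longrightarrow> g \<in> L2_S2 \<Longrightarrow> (\<lambda>s. f s - g s) \<in> L2_S2"
  using L2_S2_add[of f "\<lambda>s. (-1) *\<^sub>R g s"] L2_S2_scaleR[of g "-1"] by simp

lemma L2_S2_sum: "(\<And>i. i \<in> I \<Longrightarrow> f i \<in> L2_S2) \<Longrightarrow> (\<lambda>s. \<Sum>i\<in>I. f i s) \<in> L2_S2"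
proof (induction I rule: infinite_finite_induct)
  case (insert i I)
  then show ?case by (simp add: L2_S2_add)
qed (simp_all add: L2_S2_continuous)

lemma L2_S2_norm: "f \<in> L2_S2 \<Longrightarrow> (\<lambda>s. norm (f s)) \<in> L2_S2"
  by (auto simp: L2_S2_def)

lemma L2_S2_Pair:
  assumes "f \<in> L2_S2" "g \<in> L2_S2"
  shows "(\<lambda>s. (f s, g s)) \<in> L2_S2"
proof (rule L2_S2_bound[where h = "\<lambda>s. (norm (f s))\<^sup>2 + (norm (g s))\<^sup>2"])
  show "(\<lambda>s. (f s, g s)) \<in> borel_measurable area_S2"
    using L2_S2_measurable[OF assms(1)] L2_S2_measurable[OF assms(2)] by (rule borel_measurable_Pair)
  show "integrable area_S2 (\<lambda>s. (norm (f s))\<^sup>2 + (norm (g s))\<^sup>2)"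
    by (intro Bochner_Integration.integrable_add L2_S2_integrable_norm assms)
qed (simp add: norm_Pair)

lemma L2_S2_integrable_inner:
  assumes "f \<in> L2_S2" "g \<in> L2_S2"
  shows "integrable area_S2 (\<lambda>s. f s \<bullet> g s)"
proof -
  note [measurable] = L2_S2_measurable[OF assms(1)] L2_S2_measurable[OF assms(2)]
  have "\<bar>f s \<bullet> g s\<bar> \<le> (norm (f s))\<^sup>2 + (norm (g s))\<^sup>2" for s
  proof -
    have "\<bar>f s \<bullet> g s\<bar> \<le> norm (f s) * norm (g s)"
      by (rule Cauchy_Schwarz_ineq2)
    also have "\<dots> \<le> (norm (f s))\<^sup>2 + (norm (g s))\<^sup>2"
      using sum_squares_bound[of "norm (f s)" "norm (g s)"] mult_nonneg_nonneg[OF norm_ge_zero norm_ge_zero, of "f s" "g s"]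
      by linarith
    finally show ?thesis .
  qed
  then have "norm (f s \<bullet> g s) \<le> norm ((norm (f s))\<^sup>2 + (norm (g s))\<^sup>2)" for s
    by simp
  moreover have "integrable area_S2 (\<lambda>s. (norm (f s))\<^sup>2 + (norm (g s))\<^sup>2)"
    by (intro Bochner_Integration.integrable_add L2_S2_integrable_norm assms)
  moreover have "(\<lambda>s. f s \<bullet> g s) \<in> borel_measurable area_S2"
    by measurable
  ultimately show ?thesis
    by (rule Bochner_Integration.integrable_bound[rotated 2, OF AE_I2])
qed

lemma L2_S2_integrable_mult:
  "f \<in> L2_S2 \<Longrightarrow> g \<in> L2_S2 \<Longrightarrow> integrable area_S2 (\<lambda>s. f s * g s :: real)"
  using L2_S2_integrable_inner[of f g] by simp

lemma L2_S2_integrable: "f \<in> L2_S2 \<Longrightarrow> integrable area_S2 (f :: _ \<Rightarrow> real)"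
  using L2_S2_integrable_mult[of f "\<lambda>_. 1"] by (simp add: L2_S2_continuous)

lemma L2_inner_commute: "L2_inner f g = L2_inner g f"
  by (simp add: L2_inner_def inner_commute)

lemma L2_inner_diff_left:
  "f \<in> L2_S2 \<Longrightarrow> g \<in> L2_S2 \<Longrightarrow> h \<in> L2_S2 \<Longrightarrow> L2_inner (\<lambda>s. f s - g s) h = L2_inner f h - L2_inner g h"
  by (simp add: L2_inner_def inner_diff_left L2_S2_integrable_inner)

lemma L2_inner_diff_right:
  "f \<in> L2_S2 \<Longrightarrow> g \<in> L2_S2 \<Longrightarrow> h \<in> L2_S2 \<Longrightarrow> L2_inner h (\<lambda>s. f s - g s) = L2_inner h f - L2_inner h g"
  by (simp add: L2_inner_def inner_diff_right L2_S2_integrable_inner)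

lemma L2_inner_sum_scaleR_left:
  assumes "\<And>i. i \<in> I \<Longrightarrow> f i \<in> L2_S2" "h \<in> L2_S2"
  shows "L2_inner (\<lambda>s. \<Sum>i\<in>I. c i *\<^sub>R f i s) h = (\<Sum>i\<in>I. c i * L2_inner (f i) h)"
  using assms by (simp add: L2_inner_def inner_sum_left L2_S2_integrable_inner)

lemma L2_inner_sum_scaleR_right:
  assumes "\<And>i. i \<in> I \<Longrightarrow> f i \<in> L2_S2" "h \<in> L2_S2"
  shows "L2_inner h (\<lambda>s. \<Sum>i\<in>I. c i *\<^sub>R f i s) = (\<Sum>i\<in>I. c i * L2_inner h (f i))"
  using L2_inner_sum_scaleR_left[OF assms, where c = c] by (simp only: L2_inner_commute)

lemma L2_inner_Pair:
  assumes "f \<in> L2_S2" "g \<in> L2_S2" "f' \<in> L2_S2" "g' \<in> L2_S2"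
  shows "L2_inner (\<lambda>s. (f s, g s)) (\<lambda>s. (f' s, g' s)) = L2_inner f f' + L2_inner g g'"
  using assms by (simp add: L2_inner_def L2_S2_integrable_inner)

lemma inner_S2_bounds:
  assumes "s \<in> S2" "t \<in> S2"
  shows "s \<bullet> t \<in> {-1..1}"
  using Cauchy_Schwarz_ineq2[of s t] assms by (auto simp: S2_def abs_le_iff)

lemma zonal_bounded:
  obtains B where "B \<ge> 0" "\<And>s t. s \<in> S2 \<Longrightarrow> t \<in> S2 \<Longrightarrow> \<bar>poly (p::real poly) (s \<bullet> t)\<bar> \<le> B"
proof -
  have "compact (poly p ` {-1..1})"
    by (intro compact_continuous_image continuous_intros) auto
  then have "bounded (poly p ` {-1..1})"
    by (rule compact_imp_bounded)
  then obtain B where "\<forall>x\<in>{-1..1}. \<bar>poly p x\<bar> \<le> B"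
    unfolding bounded_iff by auto
  note B = bspec[OF this]
  show thesis
  proof
    show "B \<ge> 0"
      by (rule order.trans[OF abs_ge_zero B[of 0]]) simp
    show "\<bar>poly p (s \<bullet> t)\<bar> \<le> B" if "s \<in> S2" "t \<in> S2" for s t
      by (rule B[OF inner_S2_bounds[OF that]])
  qed
qed

section \<open>Smoothing by zonal kernels\<close>

definition zonal_conv :: "real poly \<Rightarrow> (real^3 \<Rightarrow> real) \<Rightarrow> real^3 \<Rightarrow> real" where
  "zonal_conv k f s = (LINT t|area_S2. poly k (s \<bullet> t) * f t)"

lemma L2_S2_zonal: "(\<lambda>t. poly p (s \<bullet> t)) \<in> L2_S2"
  by (intro L2_S2_continuous continuous_intros)

lemma zonal_conv_measurable [measurable]:
  assumes "f \<in> borel_measurable area_S2"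
  shows "zonal_conv k f \<in> borel_measurable area_S2"
  unfolding zonal_conv_def[abs_def] using assms by measurable

text \<open>The bound is a maximum of the kernel times the L1 norm of f. Smoothing thus turns a
  square-integrable function into one with bounded values at all points, as the positivity test
  requires.\<close>

lemma zonal_conv_bounded:
  assumes f: "f \<in> L2_S2"
  obtains B where "B \<ge> 0" "\<And>s. s \<in> S2 \<Longrightarrow> \<bar>zonal_conv k f s\<bar> \<le> B"
proof -
  obtain C where C: "C \<ge> 0" "\<And>s t. s \<in> S2 \<Longrightarrow> t \<in> S2 \<Longrightarrow> \<bar>poly k (s \<bullet> t)\<bar> \<le> C"
    by (rule zonal_bounded[of k], rule that)
  have "\<bar>zonal_conv k f s\<bar> \<le> (LINT t|area_S2. C * \<bar>f t\<bar>)" if "s \<in> S2" for s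
  proof -
    have int: "integrable area_S2 (\<lambda>t. \<bar>poly k (s \<bullet> t) * f t\<bar>)"
      by (rule integrable_abs[OF L2_S2_integrable_mult[OF L2_S2_zonal f]])
    have "\<bar>zonal_conv k f s\<bar> \<le> (LINT t|area_S2. \<bar>poly k (s \<bullet> t) * f t\<bar>)"
      unfolding zonal_conv_def by (rule integral_abs_bound)
    also have "\<dots> \<le> (LINT t|area_S2. C * \<bar>f t\<bar>)"
      using L2_S2_integrable[OF f] C that
      by (intro integral_mono[OF int]) (auto simp: abs_mult intro!: mult_right_mono)
    finally show ?thesis .
  qed
  then show thesis
    using that[of "LINT t|area_S2. C * \<bar>f t\<bar>"] C(1) by (auto intro!: integral_nonneg_AE)
qed

lemma zonal_conv_L2:
  assumes "f \<in> L2_S2"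
  shows "zonal_conv k f \<in> L2_S2"
proof -
  obtain B where "\<And>s. s \<in> S2 \<Longrightarrow> \<bar>zonal_conv k f s\<bar> \<le> B"
    using zonal_conv_bounded[OF assms] by blast
  then show ?thesis
    using zonal_conv_measurable[OF L2_S2_measurable[OF assms]]
    by (intro L2_S2_bounded[where B = B]) auto
qed

lemma zonal_conv_diff:
  "f \<in> L2_S2 \<Longrightarrow> g \<in> L2_S2 \<Longrightarrow> zonal_conv k (\<lambda>t. f t - g t) s = zonal_conv k f s - zonal_conv k g s"
  by (simp add: zonal_conv_def right_diff_distrib L2_S2_integrable_mult L2_S2_zonal)

text \<open>The mass is 1/(2 pi) because the integral of a zonal function over the sphere is 2 pi
  times \<open>poly_int\<close>.\<close>

locale zonal_probability_kernel =
  fixes k :: "real poly"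
  assumes nonneg: "\<And>x. x \<in> {-1..1} \<Longrightarrow> poly k x \<ge> 0"
    and poly_int_eq: "poly_int k = 1 / (2 * pi)"
begin

lemma kernel_nonneg: "s \<in> S2 \<Longrightarrow> t \<in> S2 \<Longrightarrow> poly k (s \<bullet> t) \<ge> 0"
  by (intro nonneg inner_S2_bounds)

lemma integral_kernel: "s \<in> S2 \<Longrightarrow> (LINT t|area_S2. poly k (s \<bullet> t)) = 1"
  by (simp add: integral_area_S2_zonal poly_int_eq)

lemma integrable_kernel_mult:
  assumes f: "integrable area_S2 f"
  shows "integrable area_S2 (\<lambda>t. poly k (s \<bullet> t) * f t)"
proof -
  have "bounded ((\<lambda>t. poly k (s \<bullet> t)) ` S2)"
    by (intro compact_imp_bounded compact_continuous_image compact_S2 continuous_intros)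
  then obtain B where B: "\<And>t. t \<in> S2 \<Longrightarrow> \<bar>poly k (s \<bullet> t)\<bar> \<le> B"
    by (auto simp: bounded_iff)
  show ?thesis
  proof (rule Bochner_Integration.integrable_bound)
    show "integrable area_S2 (\<lambda>t. B * f t)" using f by simp
    show "AE t in area_S2. norm (poly k (s \<bullet> t) * f t) \<le> norm (B * f t)"
      using B by (intro AE_I2) (auto simp: abs_mult intro!: mult_right_mono order.trans[OF _ abs_ge_self[of B]])
  qed (use f in measurable)
qed

text \<open>The variance of f under the probability density k(s \<bullet> t), whose mean is c, is
  nonnegative.\<close>

lemma Jensen:
  assumes s: "s \<in> S2" and f: "f \<in> L2_S2"
  shows "(zonal_conv k f s)\<^sup>2 \<le> zonal_conv k (\<lambda>t. (f t)\<^sup>2) s"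
proof -
  define c where "c = zonal_conv k f s"
  have int: "integrable area_S2 (\<lambda>t. poly k (s \<bullet> t) * f t)" "integrable area_S2 (\<lambda>t. poly k (s \<bullet> t) * (f t)\<^sup>2)"
    "integrable area_S2 (\<lambda>t. poly k (s \<bullet> t))"
    using L2_S2_integrable[OF f] L2_S2_integrable_norm[OF f] L2_S2_integrable[OF L2_S2_zonal]
    by (auto intro!: integrable_kernel_mult)
  have "0 \<le> (LINT t|area_S2. poly k (s \<bullet> t) * (f t - c)\<^sup>2)"
    using s by (intro integral_nonneg_AE AE_I2) (auto intro!: mult_nonneg_nonneg kernel_nonneg)
  also have "\<dots> = (LINT t|area_S2. poly k (s \<bullet> t) * (f t)\<^sup>2 - 2 * c * (poly k (s \<bullet> t) * f t) + c\<^sup>2 * poly k (s \<bullet> t))"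
    by (intro Bochner_Integration.integral_cong refl) (simp add: power2_eq_square algebra_simps)
  also have "\<dots> = zonal_conv k (\<lambda>t. (f t)\<^sup>2) s - 2 * c * c + c\<^sup>2"
    using int by (simp add: integral_kernel[OF s] zonal_conv_def[symmetric] c_def)
  finally show ?thesis by (simp add: c_def power2_eq_square)
qed

text \<open>Fubini: s \<bullet> t is symmetric, so the kernel has mass one in either
  variable.\<close>

lemma integral_zonal_conv:
  assumes f: "integrable area_S2 f"
  shows "integrable area_S2 (zonal_conv k f)" "(LINT s|area_S2. zonal_conv k f s) = (LINT s|area_S2. f s)"
proof -
  interpret P: pair_sigma_finite area_S2 area_S2 ..
  note [measurable] = borel_measurable_integrable[OF f]
  have int: "integrable (area_S2 \<Otimes>\<^sub>M area_S2) (\<lambda>(t, s). poly k (s \<bullet> t) * f t)"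
  proof (rule P.Fubini_integrable)
    have "(LINT s|area_S2. norm (case (t, s) of (t, s) \<Rightarrow> poly k (s \<bullet> t) * f t)) = \<bar>f t\<bar>" if t: "t \<in> S2" for t
    proof -
      have "(LINT s|area_S2. norm (case (t, s) of (t, s) \<Rightarrow> poly k (s \<bullet> t) * f t))
          = (LINT s|area_S2. poly k (t \<bullet> s) * \<bar>f t\<bar>)"
        using kernel_nonneg[OF _ t] by (intro Bochner_Integration.integral_cong refl) (simp add: abs_mult inner_commute)
      then show ?thesis by (simp add: integral_kernel[OF t])
    qed
    then show "integrable area_S2 (\<lambda>t. LINT s|area_S2. norm (case (t, s) of (t, s) \<Rightarrow> poly k (s \<bullet> t) * f t))"
      using f by (subst Bochner_Integration.integrable_cong[OF refl, where g = "\<lambda>t. \<bar>f t\<bar>"]) auto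
    show "AE t in area_S2. integrable area_S2 (\<lambda>s. case (t, s) of (t, s) \<Rightarrow> poly k (s \<bullet> t) * f t)"
      using L2_S2_integrable[OF L2_S2_zonal, of k] by (simp add: inner_commute)
  qed measurable
  show "integrable area_S2 (zonal_conv k f)"
    using P.integrable_snd[OF int] by (simp add: zonal_conv_def[abs_def])
  have "(LINT s|area_S2. zonal_conv k f s) = (LINT t|area_S2. LINT s|area_S2. poly k (s \<bullet> t) * f t)"
    using P.Fubini_integral[OF int] by (simp add: zonal_conv_def)
  also have "\<dots> = (LINT t|area_S2. f t)"
    by (intro Bochner_Integration.integral_cong refl)
       (use integral_kernel in \<open>simp add: inner_commute\<close>)
  finally show "(LINT s|area_S2. zonal_conv k f s) = (LINT s|area_S2. f s)" .
qed

lemma zonal_conv_contraction: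
  assumes f: "f \<in> L2_S2"
  shows "(LINT s|area_S2. (zonal_conv k f s)\<^sup>2) \<le> (LINT s|area_S2. (f s)\<^sup>2)"
proof -
  have f2: "integrable area_S2 (\<lambda>t. (f t)\<^sup>2)"
    using L2_S2_integrable_norm[OF f] by simp
  have "(LINT s|area_S2. (zonal_conv k f s)\<^sup>2) \<le> (LINT s|area_S2. zonal_conv k (\<lambda>t. (f t)\<^sup>2) s)"
    using L2_S2_integrable_norm[OF zonal_conv_L2[OF f]] integral_zonal_conv(1)[OF f2] Jensen[OF _ f]
    by (intro integral_mono) auto
  also have "\<dots> = (LINT s|area_S2. (f s)\<^sup>2)"
    by (rule integral_zonal_conv(2)[OF f2])
  finally show ?thesis .
qed

end

section \<open>The estimate for smoothed families\<close>

text \<open>Positivity tested with w = V f_j and summed over j says that the integral of V(s) V(r) R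
  (H - R) is nonnegative. Hence the Hilbert-Schmidt norm of R with weight V(s) V(r) is at most that
  of H, whose square is at most E X with X the integral of V^2. The squared norm of R is at least
  X^2 / card J, since R has rank at most card J and weighted trace X.\<close>

lemma (in finite_measure) integral_density_square_le:
  fixes f :: "'i \<Rightarrow> 'a \<Rightarrow> real" and H :: "'a \<Rightarrow> 'a \<Rightarrow> real"
  assumes J: "finite J"
    and f_meas: "\<And>j. j \<in> J \<Longrightarrow> f j \<in> borel_measurable M"
    and f_bounded: "\<And>j. j \<in> J \<Longrightarrow> \<exists>C. \<forall>s\<in>space M. \<bar>f j s\<bar> \<le> C"
    and H_meas: "(\<lambda>(s, r). H s r) \<in> borel_measurable (M \<Otimes>\<^sub>M M)"
    and H_le: "\<And>s r. s \<in> space M \<Longrightarrow> r \<in> space M \<Longrightarrow> \<bar>H s r\<bar> \<le> B"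
    and H_sym: "\<And>s r. s \<in> space M \<Longrightarrow> r \<in> space M \<Longrightarrow> H s r = H r s"
    and H_row: "\<And>r. r \<in> space M \<Longrightarrow> (LINT s|M. (H s r)\<^sup>2) \<le> E" and E: "E \<ge> 0"
    and pos: "\<And>w C. w \<in> borel_measurable M \<Longrightarrow> (\<And>s. s \<in> space M \<Longrightarrow> \<bar>w s\<bar> \<le> C) \<Longrightarrow>
      0 \<le> (LINT p|(M \<Otimes>\<^sub>M M). w (fst p) * w (snd p) * (H (fst p) (snd p) - (\<Sum>j\<in>J. f j (fst p) * f j (snd p))))"
  shows "(LINT s|M. (\<Sum>j\<in>J. (f j s)\<^sup>2)\<^sup>2) \<le> real (card J) * E"
proof -
  interpret P: pair_sigma_finite M M ..
  interpret PP: finite_measure "M \<Otimes>\<^sub>M M"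
    by (rule finite_measure_pair_measure) unfold_locales
  define R where "R = (\<lambda>s r. \<Sum>j\<in>J. f j s * f j r)"
  from f_bounded obtain C where C: "\<And>j s. j \<in> J \<Longrightarrow> s \<in> space M \<Longrightarrow> \<bar>f j s\<bar> \<le> C j"
    by metis
  define V where "V = (\<lambda>s. \<Sum>j\<in>J. (f j s)\<^sup>2)"
  define CV where "CV = (\<Sum>j\<in>J. C j * C j)"
  have abs_mult_le: "\<bar>x * y\<bar> \<le> X * Y" if "\<bar>x\<bar> \<le> X" "\<bar>y\<bar> \<le> Y" for x y X Y :: real
    unfolding abs_mult using that by (intro mult_mono) auto
  have V_nonneg: "V s \<ge> 0" for s by (simp add: V_def sum_nonneg)
  have R_le: "\<bar>R s r\<bar> \<le> CV" if "s \<in> space M" "r \<in> space M" for s r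
    unfolding R_def CV_def by (intro order.trans[OF sum_abs] sum_mono abs_mult_le C that)
  have V_abs: "\<bar>V s\<bar> \<le> CV" if "s \<in> space M" for s
    using R_le[OF that that] by (simp add: V_def R_def power2_eq_square)
  have V_meas [measurable]: "V \<in> borel_measurable M"
    unfolding V_def by (intro borel_measurable_sum borel_measurable_power f_meas)
  have f_meas_fst: "(\<lambda>p. f j (fst p)) \<in> borel_measurable (M \<Otimes>\<^sub>M M)"
    and f_meas_snd: "(\<lambda>p. f j (snd p)) \<in> borel_measurable (M \<Otimes>\<^sub>M M)" if "j \<in> J" for j
    using f_meas[OF that] by measurable
  have R_meas [measurable]: "(\<lambda>p. R (fst p) (snd p)) \<in> borel_measurable (M \<Otimes>\<^sub>M M)"
    unfolding R_def by (intro borel_measurable_sum borel_measurable_times f_meas_fst f_meas_snd)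
  have [measurable]: "(\<lambda>p. H (fst p) (snd p)) \<in> borel_measurable (M \<Otimes>\<^sub>M M)"
    using H_meas by (simp add: case_prod_unfold)
  let ?P = "M \<Otimes>\<^sub>M M"
  let ?VV = "\<lambda>p. V (fst p) * V (snd p)"
  \<comment> \<open>Bounded measurable functions on the product. Being closed under products and
    differences, this class supplies the integrability claims on the product space.\<close>
  define \<B> where "\<B> = {h :: 'a \<times> 'a \<Rightarrow> real. h \<in> borel_measurable ?P \<and> (\<exists>B. \<forall>p\<in>space ?P. \<bar>h p\<bar> \<le> B)}"
  have \<B>_integrable: "integrable ?P h" if "h \<in> \<B>" for h
  proof -
    from that obtain B where "h \<in> borel_measurable ?P" "\<And>p. p \<in> space ?P \<Longrightarrow> \<bar>h p\<bar> \<le> B"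
      by (auto simp: \<B>_def)
    then show ?thesis
      by (intro PP.integrable_const_bound[where B = B] AE_I2) simp_all
  qed
  have \<B>_mult: "(\<lambda>p. h p * h' p) \<in> \<B>" if "h \<in> \<B>" "h' \<in> \<B>" for h h'
    using that abs_mult_le unfolding \<B>_def by (auto intro!: borel_measurable_times) blast
  have \<B>_diff: "(\<lambda>p. h p - h' p) \<in> \<B>" if "h \<in> \<B>" "h' \<in> \<B>" for h h'
  proof -
    from that obtain B B' where "\<And>p. p \<in> space ?P \<Longrightarrow> \<bar>h p\<bar> \<le> B" "\<And>p. p \<in> space ?P \<Longrightarrow> \<bar>h' p\<bar> \<le> B'"
      by (auto simp: \<B>_def)
    then have "\<forall>p\<in>space ?P. \<bar>h p - h' p\<bar> \<le> B + B'"
      by (intro ballI order.trans[OF abs_triangle_ineq4] add_mono)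
    with that show ?thesis by (auto simp: \<B>_def)
  qed
  have \<B>_V: "(\<lambda>p. V (fst p)) \<in> \<B>" "(\<lambda>p. V (snd p)) \<in> \<B>"
    using V_abs by (auto simp: \<B>_def space_pair_measure intro!: exI[of _ CV])
  have \<B>_f: "(\<lambda>p. f j (fst p)) \<in> \<B>" "(\<lambda>p. f j (snd p)) \<in> \<B>" if "j \<in> J" for j
    using C[OF that] f_meas_fst[OF that] f_meas_snd[OF that]
    by (auto simp: \<B>_def space_pair_measure intro!: exI[of _ "C j"])
  have \<B>_H: "(\<lambda>p. H (fst p) (snd p)) \<in> \<B>"
    using H_le by (auto simp: \<B>_def space_pair_measure intro!: exI[of _ B])
  have \<B>_R: "(\<lambda>p. R (fst p) (snd p)) \<in> \<B>"
    using R_le by (auto simp: \<B>_def space_pair_measure intro!: exI[of _ CV])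
  note \<B> = \<B>_mult \<B>_diff \<B>_V \<B>_f \<B>_H \<B>_R

  \<comment> \<open>the positivity assumption for \<open>w = V f\<^sub>j\<close>, to be summed over \<open>j\<close>\<close>
  let ?Q = "\<lambda>j p. ?VV p * (f j (fst p) * f j (snd p)) * (H (fst p) (snd p) - R (fst p) (snd p))"
  have Q: "0 \<le> (LINT p|?P. ?Q j p)" and Q_int: "integrable ?P (?Q j)" if j: "j \<in> J" for j
  proof -
    note [measurable] = f_meas[OF j] f_meas_fst[OF j] f_meas_snd[OF j]
    have "0 \<le> (LINT p|?P. (V (fst p) * f j (fst p)) * (V (snd p) * f j (snd p)) * (H (fst p) (snd p) - R (fst p) (snd p)))"
      unfolding R_def by (rule pos[where C = "CV * C j"]) (measurable, intro abs_mult_le V_abs C j)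
    then show "0 \<le> (LINT p|?P. ?Q j p)"
      by (simp add: mult_ac)
    show "integrable ?P (?Q j)"
      by (intro \<B>_integrable \<B> j)
  qed
  have RH_int: "integrable ?P (\<lambda>p. ?VV p * (R (fst p) (snd p) * (H (fst p) (snd p) - R (fst p) (snd p))))"
    and HH_int: "integrable ?P (\<lambda>p. ?VV p * (H (fst p) (snd p))\<^sup>2)"
    and RR_int: "integrable ?P (\<lambda>p. ?VV p * (R (fst p) (snd p))\<^sup>2)"
    and VH_int: "integrable ?P (\<lambda>p. (V (fst p))\<^sup>2 * (H (fst p) (snd p))\<^sup>2)"
                "integrable ?P (\<lambda>p. (V (snd p))\<^sup>2 * (H (fst p) (snd p))\<^sup>2)"
    unfolding power2_eq_square
    by (intro \<B>_integrable \<B>)+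

  have "0 \<le> (\<Sum>j\<in>J. (LINT p|?P. ?Q j p))"
    using Q by (intro sum_nonneg)
  also have "\<dots> = (LINT p|?P. (\<Sum>j\<in>J. ?Q j p))"
    using Q_int by (intro Bochner_Integration.integral_sum[symmetric])
  also have "\<dots> = (LINT p|?P. ?VV p * (R (fst p) (snd p) * (H (fst p) (snd p) - R (fst p) (snd p))))"
    by (simp add: R_def sum_distrib_left sum_distrib_right mult.assoc)
  \<comment> \<open>The inequality y (x - y) <= (x^2 - y^2)/2 with x = H and y = R, under the
    nonnegative weight V V, turns the mixed term into a comparison of R^2 with H^2.\<close>
  also have "\<dots> \<le> (LINT p|?P. 1/2 * (?VV p * (H (fst p) (snd p))\<^sup>2) - 1/2 * (?VV p * (R (fst p) (snd p))\<^sup>2))"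
  proof (rule integral_mono[OF RH_int])
    show "integrable ?P (\<lambda>p. 1/2 * (?VV p * (H (fst p) (snd p))\<^sup>2) - 1/2 * (?VV p * (R (fst p) (snd p))\<^sup>2))"
      using HH_int RR_int by (intro Bochner_Integration.integrable_diff integrable_mult_right)
    show "?VV p * (R (fst p) (snd p) * (H (fst p) (snd p) - R (fst p) (snd p)))
        \<le> 1/2 * (?VV p * (H (fst p) (snd p))\<^sup>2) - 1/2 * (?VV p * (R (fst p) (snd p))\<^sup>2)" for p
    proof -
      have "y * (x - y) \<le> 1/2 * x\<^sup>2 - 1/2 * y\<^sup>2" for x y :: real
        using zero_le_power2[of "x - y"] by (simp add: power2_eq_square algebra_simps)
      from mult_left_mono[OF this, of "?VV p"] show ?thesis
        by (simp add: V_nonneg right_diff_distrib mult.left_commute)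
    qed
  qed
  also have "\<dots> = 1/2 * (LINT p|?P. ?VV p * (H (fst p) (snd p))\<^sup>2) - 1/2 * (LINT p|?P. ?VV p * (R (fst p) (snd p))\<^sup>2)"
    using HH_int RR_int by simp
  finally have RR_le_HH: "(LINT p|?P. ?VV p * (R (fst p) (snd p))\<^sup>2) \<le> (LINT p|?P. ?VV p * (H (fst p) (snd p))\<^sup>2)"
    by simp

  define X where "X = (LINT s|M. (V s)\<^sup>2)"
  have VV_int: "integrable M (\<lambda>s. (V s)\<^sup>2)"
    unfolding power2_eq_square
    by (rule integrable_const_bound[where B = "CV * CV"])
       (unfold real_norm_def, intro AE_I2 abs_mult_le V_abs, measurable)
  have VH_le: "(LINT s|M. (V s)\<^sup>2 * (LINT r|M. (H r s)\<^sup>2)) \<le> X * E"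
  proof -
    have "(LINT s|M. (V s)\<^sup>2 * (LINT r|M. (H r s)\<^sup>2)) \<le> (LINT s|M. (V s)\<^sup>2 * E)"
    proof (rule integral_mono')
      show "integrable M (\<lambda>s. (V s)\<^sup>2 * E)" using VV_int by simp
      show "(V s)\<^sup>2 * (LINT r|M. (H r s)\<^sup>2) \<le> (V s)\<^sup>2 * E" if "s \<in> space M" for s
        using H_row[of s] that by (intro mult_left_mono) auto
      show "0 \<le> (V s)\<^sup>2 * E" for s
        using E by simp
    qed
    then show ?thesis by (simp add: X_def)
  qed
  have V1: "(LINT p|?P. (V (fst p))\<^sup>2 * (H (fst p) (snd p))\<^sup>2) \<le> X * E"
  proof -
    have "(LINT p|?P. (V (fst p))\<^sup>2 * (H (fst p) (snd p))\<^sup>2)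
        = (LINT s|M. LINT r|M. (V s)\<^sup>2 * (H s r)\<^sup>2)"
      using P.integral_fst'[OF VH_int(1)] by simp
    also have "\<dots> = (LINT s|M. (V s)\<^sup>2 * (LINT r|M. (H r s)\<^sup>2))"
      by (intro Bochner_Integration.integral_cong refl)
         (simp, intro disjI2 Bochner_Integration.integral_cong refl, simp add: H_sym)
    finally show ?thesis using VH_le by simp
  qed
  have V2: "(LINT p|?P. (V (snd p))\<^sup>2 * (H (fst p) (snd p))\<^sup>2) \<le> X * E"
  proof -
    have "(LINT p|?P. (V (snd p))\<^sup>2 * (H (fst p) (snd p))\<^sup>2)
        = (LINT s|M. LINT r|M. (V s)\<^sup>2 * (H r s)\<^sup>2)"
      using P.integral_snd[of "\<lambda>r s. (V s)\<^sup>2 * (H r s)\<^sup>2"] VH_int(2) by (simp add: case_prod_unfold)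
    then show ?thesis using VH_le by simp
  qed
  \<comment> \<open>Bounding V(s) V(r) by the mean of V(s)^2 and V(r)^2 separates the variables and
    leaves row integrals of H^2.\<close>
  have "(LINT p|?P. ?VV p * (H (fst p) (snd p))\<^sup>2)
      \<le> (LINT p|?P. 1/2 * ((V (fst p))\<^sup>2 * (H (fst p) (snd p))\<^sup>2) + 1/2 * ((V (snd p))\<^sup>2 * (H (fst p) (snd p))\<^sup>2))"
  proof (rule integral_mono[OF HH_int])
    show "integrable ?P (\<lambda>p. 1/2 * ((V (fst p))\<^sup>2 * (H (fst p) (snd p))\<^sup>2) + 1/2 * ((V (snd p))\<^sup>2 * (H (fst p) (snd p))\<^sup>2))"
      using VH_int by (intro Bochner_Integration.integrable_add integrable_mult_right)
    show "?VV p * (H (fst p) (snd p))\<^sup>2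
        \<le> 1/2 * ((V (fst p))\<^sup>2 * (H (fst p) (snd p))\<^sup>2) + 1/2 * ((V (snd p))\<^sup>2 * (H (fst p) (snd p))\<^sup>2)" for p
    proof -
      have "?VV p \<le> 1/2 * (V (fst p))\<^sup>2 + 1/2 * (V (snd p))\<^sup>2"
        using sum_squares_bound[of "V (fst p)" "V (snd p)"] by simp
      from mult_right_mono[OF this, of "(H (fst p) (snd p))\<^sup>2"] show ?thesis
        by (simp add: distrib_right mult.assoc)
    qed
  qed
  also have "\<dots> = 1/2 * (LINT p|?P. (V (fst p))\<^sup>2 * (H (fst p) (snd p))\<^sup>2) + 1/2 * (LINT p|?P. (V (snd p))\<^sup>2 * (H (fst p) (snd p))\<^sup>2)"
    using VH_int by simp
  also have "\<dots> \<le> X * E"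
    using V1 V2 by simp
  finally have RR_le: "(LINT p|?P. ?VV p * (R (fst p) (snd p))\<^sup>2) \<le> X * E"
    using RR_le_HH by simp

  \<comment> \<open>The Gram matrix of the f_j with weight V: its squared Frobenius norm is the
    weighted integral of R^2, and its trace is X.\<close>
  define a where "a = (\<lambda>i j. LINT s|M. V s * f i s * f j s)"
  have Vff_meas: "(\<lambda>s. V s * f i s * f j s) \<in> borel_measurable M" if "i \<in> J" "j \<in> J" for i j
    by (intro borel_measurable_times V_meas f_meas that)
  have Vff_int: "integrable M (\<lambda>s. V s * f i s * f j s)" if ij: "i \<in> J" "j \<in> J" for i j
    by (rule integrable_const_bound[OF _ Vff_meas[OF ij], where B = "CV * C i * C j"])
       (unfold real_norm_def, intro AE_I2 abs_mult_le V_abs C ij)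
  have tensor_int: "integrable ?P (\<lambda>p. (V (fst p) * f i (fst p) * f j (fst p)) * (V (snd p) * f i (snd p) * f j (snd p)))"
    if ij: "i \<in> J" "j \<in> J" for i j
    by (intro \<B>_integrable \<B> ij)
  have tensor: "(LINT p|?P. (V (fst p) * f i (fst p) * f j (fst p)) * (V (snd p) * f i (snd p) * f j (snd p))) = (a i j)\<^sup>2"
    if ij: "i \<in> J" "j \<in> J" for i j
    using P.integral_fst'[OF tensor_int[OF ij]] Vff_int[OF ij] by (simp add: a_def power2_eq_square)
  have RR_eq: "(LINT p|?P. ?VV p * (R (fst p) (snd p))\<^sup>2) = (\<Sum>i\<in>J. \<Sum>j\<in>J. (a i j)\<^sup>2)"
  proof -
    have "(LINT p|?P. ?VV p * (R (fst p) (snd p))\<^sup>2)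
        = (LINT p|?P. (\<Sum>i\<in>J. \<Sum>j\<in>J. (V (fst p) * f i (fst p) * f j (fst p)) * (V (snd p) * f i (snd p) * f j (snd p))))"
      unfolding R_def power2_eq_square sum_product sum_distrib_left
      by (intro Bochner_Integration.integral_cong sum.cong refl) (simp only: sum_distrib_left mult_ac)
    also have "\<dots> = (\<Sum>i\<in>J. \<Sum>j\<in>J. (a i j)\<^sup>2)"
      using tensor_int by (simp add: tensor)
    finally show ?thesis .
  qed
  have "(\<Sum>i\<in>J. a i i) = X"
  proof -
    have "(\<Sum>i\<in>J. a i i) = (LINT s|M. (\<Sum>i\<in>J. V s * f i s * f i s))"
      unfolding a_def using Vff_int by (intro Bochner_Integration.integral_sum[symmetric])
    also have "\<dots> = X"
      unfolding X_def power2_eq_square[of "V _"] by (subst (2) V_def) (simp add: sum_distrib_left power2_eq_square mult.assoc)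
    finally show ?thesis .
  qed
  \<comment> \<open>Cauchy-Schwarz for the trace; this is where the number of functions
    enters.\<close>
  then have "X\<^sup>2 \<le> (\<Sum>i\<in>J. (a i i)\<^sup>2) * real (card J)"
    using sum_squared_le_sum_of_squares[of "\<lambda>i. a i i" J] J by simp
  also have "(\<Sum>i\<in>J. (a i i)\<^sup>2) \<le> (\<Sum>i\<in>J. \<Sum>j\<in>J. (a i j)\<^sup>2)"
    using J by (intro sum_mono member_le_sum) auto
  also have "\<dots> \<le> X * E"
    using RR_le RR_eq by simp
  finally have X2: "X * X \<le> X * (real (card J) * E)"
    by (simp add: power2_eq_square mult_right_mono mult_ac)
  show ?thesis
  proof (cases "X = 0")
    case True
    then show ?thesis using E by (simp add: X_def V_def)
  next
    case False
    moreover have "X \<ge> 0" by (simp add: X_def)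
    ultimately have "X \<le> real (card J) * E" using X2 by simp
    then show ?thesis by (simp add: X_def V_def)
  qed
qed

text \<open>The assumptions on g are those that \<open>green_function_polynomial\<close>
  delivers.\<close>

locale zonal_green_function = zonal_probability_kernel +
  fixes m :: real and g :: "real poly"
  assumes m_pos: "m > 0" and poly_int_green: "poly_int g = 0"
    and green_eq: "smult (m\<^sup>2) g - legendre_op g = k - [:1 / (4 * pi):]"
    and green_norm: "poly_int (g * g) \<le> 1 / (8 * pi\<^sup>2 * m\<^sup>2)"
begin

text \<open>Pairing m f with the gradient of f, here for f = g(s \<bullet> _), makes the energy
  scalar product an ordinary L2 scalar product of functions with values in
  \<open>real \<times> real^3\<close>.\<close>

definition green_pair :: "real^3 \<Rightarrow> real^3 \<Rightarrow> real \<times> (real^3)" where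
  "green_pair s t = (m *\<^sub>R poly g (s \<bullet> t), zonal_field g s t)"

lemma zonal_field_L2: "zonal_field p s \<in> L2_S2"
  unfolding zonal_field_def[abs_def] by (intro L2_S2_continuous continuous_intros)

lemma green_L2: "(\<lambda>t. m *\<^sub>R poly g (s \<bullet> t)) \<in> L2_S2"
  by (intro L2_S2_continuous continuous_intros)

lemma green_pair_L2: "green_pair s \<in> L2_S2"
  unfolding green_pair_def[abs_def] by (intro L2_S2_Pair zonal_field_L2 green_L2)

lemma poly_green_eq: "m\<^sup>2 * poly g x - poly (legendre_op g) x = poly k x - 1 / (4 * pi)"
  using arg_cong[OF green_eq, of "\<lambda>p. poly p x"] by simp

text \<open>The derivatives fall on g, and \<open>green_eq\<close> replaces m^2 g minus its image
  under \<open>legendre_op\<close> by k - 1/(4 pi). The constant is annihilated by the zero mean of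
  \<phi>.\<close>

lemma L2_inner_green_pair_gradient:
  assumes grad: "has_weak_surface_gradient \<phi> G" and mean: "(LINT s|area_S2. \<phi> s) = 0" and s: "s \<in> S2"
  shows "L2_inner (green_pair s) (\<lambda>t. (m *\<^sub>R \<phi> t, G t)) = zonal_conv k \<phi> s"
proof -
  have \<phi>: "\<phi> \<in> L2_S2" and G: "G \<in> L2_S2"
    using grad by (auto simp: has_weak_surface_gradient_def)
  have int: "integrable area_S2 (\<lambda>t. poly p (s \<bullet> t) * \<phi> t)" for p
    by (intro L2_S2_integrable_mult L2_S2_zonal \<phi>)
  have "L2_inner (green_pair s) (\<lambda>t. (m *\<^sub>R \<phi> t, G t))
      = L2_inner (\<lambda>t. m *\<^sub>R poly g (s \<bullet> t)) (\<lambda>t. m *\<^sub>R \<phi> t) + L2_inner (zonal_field g s) G"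
    unfolding green_pair_def[abs_def] by (intro L2_inner_Pair zonal_field_L2 green_L2 L2_S2_scaleR \<phi> G)
  also have "L2_inner (zonal_field g s) G = - (LINT t|area_S2. \<phi> t * poly (legendre_op g) (s \<bullet> t))"
    using L2_inner_weak_gradient_zonal_field[OF grad s] by (simp add: L2_inner_commute)
  also have "L2_inner (\<lambda>t. m *\<^sub>R poly g (s \<bullet> t)) (\<lambda>t. m *\<^sub>R \<phi> t) = (LINT t|area_S2. m\<^sup>2 * (poly g (s \<bullet> t) * \<phi> t))"
    unfolding L2_inner_def by (simp add: power2_eq_square mult_ac)
  also have "\<dots> + - (LINT t|area_S2. \<phi> t * poly (legendre_op g) (s \<bullet> t))
      = (LINT t|area_S2. m\<^sup>2 * (poly g (s \<bullet> t) * \<phi> t) - poly (legendre_op g) (s \<bullet> t) * \<phi> t)"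
    using int by (simp add: mult.commute)
  also have "\<dots> = (LINT t|area_S2. poly k (s \<bullet> t) * \<phi> t - 1 / (4 * pi) * \<phi> t)"
    by (intro Bochner_Integration.integral_cong refl)
       (simp only: mult.assoc[symmetric] left_diff_distrib[symmetric] poly_green_eq)
  also have "\<dots> = (LINT t|area_S2. poly k (s \<bullet> t) * \<phi> t) - (LINT t|area_S2. 1 / (4 * pi) * \<phi> t)"
    using int[of k] L2_S2_integrable[OF \<phi>] by (intro Bochner_Integration.integral_diff) auto
  also have "\<dots> = zonal_conv k \<phi> s"
    by (simp add: mean zonal_conv_def)
  finally show ?thesis .
qed

text \<open>The same computation, with Green's formula in place of the weak gradient and
  \<open>poly_int_green\<close> in place of the zero mean.\<close>

lemma L2_inner_green_pair:
  assumes s: "s \<in> S2" and r: "r \<in> S2"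
  shows "L2_inner (green_pair s) (green_pair r) = zonal_conv k (\<lambda>t. poly g (r \<bullet> t)) s"
proof -
  have int: "integrable area_S2 (\<lambda>t. poly p (s \<bullet> t) * poly q (r \<bullet> t))" for p q
    by (intro L2_S2_integrable_mult L2_S2_zonal)
  have "L2_inner (green_pair s) (green_pair r) = L2_inner (\<lambda>t. m *\<^sub>R poly g (s \<bullet> t)) (\<lambda>t. m *\<^sub>R poly g (r \<bullet> t))
      + L2_inner (zonal_field g s) (zonal_field g r)"
    unfolding green_pair_def[abs_def] by (intro L2_inner_Pair zonal_field_L2 green_L2)
  also have "L2_inner (\<lambda>t. m *\<^sub>R poly g (s \<bullet> t)) (\<lambda>t. m *\<^sub>R poly g (r \<bullet> t))
      = (LINT t|area_S2. m\<^sup>2 * (poly g (s \<bullet> t) * poly g (r \<bullet> t)))"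
    by (simp add: L2_inner_def power2_eq_square mult_ac)
  also have "L2_inner (zonal_field g s) (zonal_field g r)
      = - (LINT t|area_S2. poly (legendre_op g) (s \<bullet> t) * poly g (r \<bullet> t))"
  proof -
    have "0 = (LINT t|area_S2. poly (legendre_op g) (s \<bullet> t) * poly g (r \<bullet> t) + zonal_field g s t \<bullet> zonal_field g r t)"
      unfolding integral_area_S2_Green[OF s, of g r g, symmetric]
      by (intro Bochner_Integration.integral_cong refl)
         (simp add: inner_zonal_field inner_commute mult.commute)
    also have "\<dots> = (LINT t|area_S2. poly (legendre_op g) (s \<bullet> t) * poly g (r \<bullet> t))
        + L2_inner (zonal_field g s) (zonal_field g r)"
      unfolding L2_inner_def by (intro Bochner_Integration.integral_add int L2_S2_integrable_inner zonal_field_L2)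
    finally show ?thesis by simp
  qed
  also have "(LINT t|area_S2. m\<^sup>2 * (poly g (s \<bullet> t) * poly g (r \<bullet> t)))
        + - (LINT t|area_S2. poly (legendre_op g) (s \<bullet> t) * poly g (r \<bullet> t))
      = (LINT t|area_S2. m\<^sup>2 * (poly g (s \<bullet> t) * poly g (r \<bullet> t)) - poly (legendre_op g) (s \<bullet> t) * poly g (r \<bullet> t))"
    using int by simp
  also have "\<dots> = (LINT t|area_S2. poly k (s \<bullet> t) * poly g (r \<bullet> t) - 1 / (4 * pi) * poly g (r \<bullet> t))"
    by (intro Bochner_Integration.integral_cong refl)
       (simp only: mult.assoc[symmetric] left_diff_distrib[symmetric] poly_green_eq)
  also have "\<dots> = (LINT t|area_S2. poly k (s \<bullet> t) * poly g (r \<bullet> t)) - (LINT t|area_S2. 1 / (4 * pi) * poly g (r \<bullet> t))"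
    using int[of k g] L2_S2_integrable[OF L2_S2_zonal, of g r] by (intro Bochner_Integration.integral_diff) auto
  also have "\<dots> = zonal_conv k (\<lambda>t. poly g (r \<bullet> t)) s"
    by (simp add: zonal_conv_def integral_area_S2_zonal[OF r] poly_int_green)
  finally show ?thesis .
qed

lemma green_pair_bounded:
  obtains B where "B \<ge> 0" "\<And>s t. s \<in> S2 \<Longrightarrow> t \<in> S2 \<Longrightarrow> norm (green_pair s t) \<le> B"
proof -
  obtain Cg where Cg: "Cg \<ge> 0" "\<And>s t. s \<in> S2 \<Longrightarrow> t \<in> S2 \<Longrightarrow> \<bar>poly g (s \<bullet> t)\<bar> \<le> Cg"
    by (rule zonal_bounded[of g], rule that)
  obtain Cg' where Cg': "Cg' \<ge> 0" "\<And>s t. s \<in> S2 \<Longrightarrow> t \<in> S2 \<Longrightarrow> \<bar>poly (pderiv g) (s \<bullet> t)\<bar> \<le> Cg'"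
    by (rule zonal_bounded[of "pderiv g"], rule that)
  have le: "norm (green_pair s t) \<le> m * Cg + Cg' * 2" if st: "s \<in> S2" "t \<in> S2" for s t
  proof -
    have "norm (zonal_field g s t) \<le> Cg' * 2"
    proof -
      have "norm (s - (s \<bullet> t) *\<^sub>R t) \<le> norm s + norm ((s \<bullet> t) *\<^sub>R t)"
        by (rule norm_triangle_ineq4)
      also have "\<dots> \<le> 2"
        using st inner_S2_bounds[OF st] by (simp add: S2_def abs_le_iff)
      finally show ?thesis
        unfolding zonal_field_def norm_scaleR real_norm_def using Cg'(2)[OF st] by (intro mult_mono) auto
    qed
    moreover have "norm (m *\<^sub>R poly g (s \<bullet> t)) \<le> m * Cg"
      using m_pos Cg(2)[OF st] by (simp add: abs_mult)
    ultimately show ?thesis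
      unfolding green_pair_def using norm_Pair_le[of "m *\<^sub>R poly g (s \<bullet> t)" "zonal_field g s t"] by linarith
  qed

  show thesis
    by (rule that[OF _ le]) (use m_pos Cg(1) Cg'(1) in auto)
qed

lemma zonal_conv_green_le:
  "\<exists>B. \<forall>s\<in>S2. \<forall>r\<in>S2. \<bar>zonal_conv k (\<lambda>t. poly g (r \<bullet> t)) s\<bar> \<le> B"
proof -
  obtain Cg where Cg: "Cg \<ge> 0" "\<And>s t. s \<in> S2 \<Longrightarrow> t \<in> S2 \<Longrightarrow> \<bar>poly g (s \<bullet> t)\<bar> \<le> Cg"
    by (rule zonal_bounded[of g], rule that)
  have le: "\<bar>zonal_conv k (\<lambda>t. poly g (r \<bullet> t)) s\<bar> \<le> Cg" if s: "s \<in> S2" and r: "r \<in> S2" for s r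
  proof -
    have int: "integrable area_S2 (\<lambda>t. poly k (s \<bullet> t) * poly g (r \<bullet> t))"
      by (intro L2_S2_integrable_mult L2_S2_zonal)
    have "\<bar>zonal_conv k (\<lambda>t. poly g (r \<bullet> t)) s\<bar> \<le> (LINT t|area_S2. \<bar>poly k (s \<bullet> t) * poly g (r \<bullet> t)\<bar>)"
      unfolding zonal_conv_def by (rule integral_abs_bound)
    also have "\<dots> \<le> (LINT t|area_S2. poly k (s \<bullet> t) * Cg)"
    proof (rule integral_mono[OF integrable_abs[OF int]])
      show "integrable area_S2 (\<lambda>t. poly k (s \<bullet> t) * Cg)"
        by (intro integrable_mult_left L2_S2_integrable L2_S2_zonal)
      show "\<bar>poly k (s \<bullet> t) * poly g (r \<bullet> t)\<bar> \<le> poly k (s \<bullet> t) * Cg" if "t \<in> space area_S2" for t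
        using that Cg(2)[OF r, of t] kernel_nonneg[OF s, of t] by (auto simp: abs_mult intro!: mult_left_mono)
    qed
    also have "\<dots> = Cg"
      by (simp add: integral_kernel[OF s])
    finally show ?thesis .
  qed
  show ?thesis using le by blast
qed

text \<open>Averaging with k contracts L2, so only the norm of g(r \<bullet> _) counts. This
  supplies the row bound E of \<open>integral_density_square_le\<close>.\<close>

lemma integral_zonal_conv_green_le:
  assumes r: "r \<in> S2"
  shows "(LINT s|area_S2. (zonal_conv k (\<lambda>t. poly g (r \<bullet> t)) s)\<^sup>2) \<le> 1 / (4 * pi * m\<^sup>2)"
proof -
  have "(LINT s|area_S2. (zonal_conv k (\<lambda>t. poly g (r \<bullet> t)) s)\<^sup>2) \<le> (LINT t|area_S2. (poly g (r \<bullet> t))\<^sup>2)"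
    by (rule zonal_conv_contraction[OF L2_S2_zonal])
  also have "\<dots> = 2 * pi * poly_int (g * g)"
    using integral_area_S2_zonal[OF r, of "g * g"] by (simp add: power2_eq_square)
  also have "\<dots> \<le> 2 * pi * (1 / (8 * pi\<^sup>2 * m\<^sup>2))"
    by (intro mult_left_mono green_norm) simp
  also have "\<dots> = 1 / (4 * pi * m\<^sup>2)"
    using m_pos by (simp add: power2_eq_square field_simps)
  finally show ?thesis .
qed

text \<open>The \<Phi> j are orthonormal and f j s is the coefficient of \<open>green_pair s\<close>
  along \<Phi> j. Hence \<Theta> s is the residual of an orthogonal projection, and its Gram kernel
  is H - R, which gives the required positivity.\<close>

lemma Lieb_Thirring_zonal_conv:
  fixes \<phi> :: "'i \<Rightarrow> real^3 \<Rightarrow> real"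
  assumes J: "finite J"
    and grad: "\<And>j. j \<in> J \<Longrightarrow> has_weak_surface_gradient (\<phi> j) (G j)"
    and mean: "\<And>j. j \<in> J \<Longrightarrow> (LINT s|area_S2. \<phi> j s) = 0"
    and orth: "\<And>i j. i \<in> J \<Longrightarrow> j \<in> J \<Longrightarrow>
      m\<^sup>2 * L2_inner (\<phi> i) (\<phi> j) + L2_inner (G i) (G j) = (if i = j then 1 else 0)"
  shows "(LINT s|area_S2. (\<Sum>j\<in>J. (zonal_conv k (\<phi> j) s)\<^sup>2)\<^sup>2) \<le> real (card J) / (4 * pi * m\<^sup>2)"
proof -
  have \<phi>: "\<phi> j \<in> L2_S2" and G: "G j \<in> L2_S2" if "j \<in> J" for j
    using grad[OF that] by (auto simp: has_weak_surface_gradient_def)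
  define \<Phi> where "\<Phi> = (\<lambda>j t. (m *\<^sub>R \<phi> j t, G j t))"
  have \<Phi>_L2: "\<Phi> j \<in> L2_S2" if "j \<in> J" for j
    unfolding \<Phi>_def by (intro L2_S2_Pair L2_S2_scaleR \<phi> G that)
  define f where "f = (\<lambda>j. zonal_conv k (\<phi> j))"
  define H where "H = (\<lambda>s r. zonal_conv k (\<lambda>t. poly g (r \<bullet> t)) s)"
  define R where "R = (\<lambda>s r. \<Sum>j\<in>J. f j s * f j r)"
  have \<Gamma>\<Phi>: "L2_inner (green_pair s) (\<Phi> j) = f j s" if "s \<in> S2" "j \<in> J" for s j
    unfolding \<Phi>_def f_def by (intro L2_inner_green_pair_gradient grad mean that)
  have H_eq: "L2_inner (green_pair s) (green_pair r) = H s r" if "s \<in> S2" "r \<in> S2" for s r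
    unfolding H_def by (intro L2_inner_green_pair that)
  have \<Phi>\<Phi>: "L2_inner (\<Phi> i) (\<Phi> j) = (if i = j then 1 else 0)" if ij: "i \<in> J" "j \<in> J" for i j
  proof -
    have "L2_inner (\<Phi> i) (\<Phi> j) = L2_inner (\<lambda>t. m *\<^sub>R \<phi> i t) (\<lambda>t. m *\<^sub>R \<phi> j t) + L2_inner (G i) (G j)"
      unfolding \<Phi>_def by (intro L2_inner_Pair L2_S2_scaleR \<phi> G ij)
    also have "L2_inner (\<lambda>t. m *\<^sub>R \<phi> i t) (\<lambda>t. m *\<^sub>R \<phi> j t) = m\<^sup>2 * L2_inner (\<phi> i) (\<phi> j)"
      by (simp add: L2_inner_def power2_eq_square mult_ac)
    finally show ?thesis using orth[OF ij] by simp
  qed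

  have f_meas: "f j \<in> borel_measurable area_S2" if "j \<in> J" for j
    unfolding f_def by (intro zonal_conv_measurable L2_S2_measurable \<phi> that)
  have f_bounded: "\<forall>j\<in>J. \<exists>C\<ge>0. \<forall>s\<in>S2. \<bar>f j s\<bar> \<le> C"
    unfolding f_def by (meson zonal_conv_bounded \<phi>)
  then obtain C where C: "\<And>j. j \<in> J \<Longrightarrow> C j \<ge> 0" "\<And>j s. j \<in> J \<Longrightarrow> s \<in> S2 \<Longrightarrow> \<bar>f j s\<bar> \<le> C j"
    by metis
  have f_meas_fst: "(\<lambda>p. f j (fst p)) \<in> borel_measurable (area_S2 \<Otimes>\<^sub>M area_S2)" if "j \<in> J" for j
    by (rule measurable_compose[OF measurable_fst f_meas[OF that]])
  obtain B where B: "B \<ge> 0" "\<And>s t. s \<in> S2 \<Longrightarrow> t \<in> S2 \<Longrightarrow> norm (green_pair s t) \<le> B"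
    by (rule green_pair_bounded, rule that)

  define \<Theta> where "\<Theta> = (\<lambda>s t. green_pair s t - (\<Sum>j\<in>J. f j s *\<^sub>R \<Phi> j t))"
  \<comment> \<open>A bound for the residual uniform in s: \<open>green_pair\<close> and the
    coefficients are bounded, whereas the \<Phi> j are only square integrable in t.\<close>
  define b where "b = (\<lambda>t. B + (\<Sum>j\<in>J. C j *\<^sub>R norm (\<Phi> j t)))"
  have b_L2: "b \<in> L2_S2"
    unfolding b_def
    by (intro L2_S2_add L2_S2_sum L2_S2_scaleR L2_S2_norm \<Phi>_L2) (auto intro: L2_S2_continuous)
  have \<Theta>_le: "norm (\<Theta> s t) \<le> b t" if "s \<in> S2" "t \<in> S2" for s t
  proof -
    have "norm (\<Theta> s t) \<le> norm (green_pair s t) + norm (\<Sum>j\<in>J. f j s *\<^sub>R \<Phi> j t)"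
      unfolding \<Theta>_def by (rule norm_triangle_ineq4)
    also have "norm (\<Sum>j\<in>J. f j s *\<^sub>R \<Phi> j t) \<le> (\<Sum>j\<in>J. C j *\<^sub>R norm (\<Phi> j t))"
      using C(2)[OF _ that(1)] by (intro order.trans[OF norm_sum] sum_mono) (auto intro!: mult_right_mono)
    finally show ?thesis
      unfolding b_def using B(2)[OF that] by linarith
  qed
  have \<Theta>_meas: "(\<lambda>(s, t). \<Theta> s t) \<in> borel_measurable (area_S2 \<Otimes>\<^sub>M area_S2)"
  proof -
    have "(\<lambda>p. \<Phi> j (snd p)) \<in> borel_measurable (area_S2 \<Otimes>\<^sub>M area_S2)" if "j \<in> J" for j
      by (rule measurable_compose[OF measurable_snd L2_S2_measurable[OF \<Phi>_L2[OF that]]])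
    moreover have "(\<lambda>p. green_pair (fst p) (snd p)) \<in> borel_measurable (area_S2 \<Otimes>\<^sub>M area_S2)"
      unfolding green_pair_def zonal_field_def by measurable
    ultimately show ?thesis
      unfolding \<Theta>_def case_prod_unfold
      by (intro borel_measurable_diff borel_measurable_sum borel_measurable_scaleR f_meas_fst)
  qed
  have \<Theta>\<Theta>: "L2_inner (\<Theta> s) (\<Theta> r) = H s r - R s r" if s: "s \<in> S2" and r: "r \<in> S2" for s r
  proof -
    have S_L2: "(\<lambda>t. \<Sum>j\<in>J. f j s *\<^sub>R \<Phi> j t) \<in> L2_S2" for s
      by (intro L2_S2_sum L2_S2_scaleR \<Phi>_L2)
    have "L2_inner (\<Theta> s) (\<Theta> r) = L2_inner (green_pair s) (green_pair r) - (\<Sum>j\<in>J. f j r * L2_inner (green_pair s) (\<Phi> j))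
        - (\<Sum>i\<in>J. f i s * (L2_inner (\<Phi> i) (green_pair r) - (\<Sum>j\<in>J. f j r * L2_inner (\<Phi> i) (\<Phi> j))))"
      unfolding \<Theta>_def
      by (simp add: L2_inner_diff_left L2_inner_diff_right S_L2 green_pair_L2 L2_S2_diff \<Phi>_L2
          L2_inner_sum_scaleR_left L2_inner_sum_scaleR_right right_diff_distrib sum_subtractf)
    \<comment> \<open>Each bracket is the scalar product of \<Phi> i with the residual \<Theta> r,
      hence 0.\<close>
    also have "(\<Sum>i\<in>J. f i s * (L2_inner (\<Phi> i) (green_pair r) - (\<Sum>j\<in>J. f j r * L2_inner (\<Phi> i) (\<Phi> j)))) = 0"
    proof (intro sum.neutral ballI)
      fix i assume i: "i \<in> J"
      have "(\<Sum>j\<in>J. f j r * L2_inner (\<Phi> i) (\<Phi> j)) = (\<Sum>j\<in>J. if j = i then f j r else 0)"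
        by (intro sum.cong refl) (auto simp: \<Phi>\<Phi> i)
      also have "\<dots> = f i r" using i J by simp
      finally show "f i s * (L2_inner (\<Phi> i) (green_pair r) - (\<Sum>j\<in>J. f j r * L2_inner (\<Phi> i) (\<Phi> j))) = 0"
        using \<Gamma>\<Phi>[OF r i] by (simp add: L2_inner_commute)
    qed
    also have "(\<Sum>j\<in>J. f j r * L2_inner (green_pair s) (\<Phi> j)) = R s r"
      unfolding R_def by (intro sum.cong refl) (simp add: \<Gamma>\<Phi>[OF s])
    finally show ?thesis by (simp add: H_eq[OF s r])
  qed

  obtain BH where BH: "\<And>s r. s \<in> S2 \<Longrightarrow> r \<in> S2 \<Longrightarrow> \<bar>H s r\<bar> \<le> BH"
    unfolding H_def using zonal_conv_green_le by blast
  have "(LINT s|area_S2. (\<Sum>j\<in>J. (f j s)\<^sup>2)\<^sup>2) \<le> real (card J) * (1 / (4 * pi * m\<^sup>2))"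
  proof (rule area_S2.integral_density_square_le[where H = H and B = BH])
    show "(\<lambda>(s, r). H s r) \<in> borel_measurable (area_S2 \<Otimes>\<^sub>M area_S2)"
      unfolding H_def zonal_conv_def by measurable
    show "H s r = H r s" if "s \<in> space area_S2" "r \<in> space area_S2" for s r
      using H_eq[of s r] H_eq[of r s] that by (simp add: L2_inner_commute)
    show "(LINT s|area_S2. (H s r)\<^sup>2) \<le> 1 / (4 * pi * m\<^sup>2)" if "r \<in> space area_S2" for r
      using integral_zonal_conv_green_le[of r] that by (simp add: H_def)
    show "\<exists>C. \<forall>s\<in>space area_S2. \<bar>f j s\<bar> \<le> C" if "j \<in> J" for j
      using C(2)[OF that] by auto
    show "0 \<le> (LINT p|(area_S2 \<Otimes>\<^sub>M area_S2). w (fst p) * w (snd p) * (H (fst p) (snd p) - (\<Sum>j\<in>J. f j (fst p) * f j (snd p))))"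
      if w: "w \<in> borel_measurable area_S2" "\<And>s. s \<in> space area_S2 \<Longrightarrow> \<bar>w s\<bar> \<le> D" for w D
    proof -
      have "0 \<le> (LINT p|(area_S2 \<Otimes>\<^sub>M area_S2). w (fst p) * w (snd p) * (LINT t|area_S2. \<Theta> (fst p) t \<bullet> \<Theta> (snd p) t))"
        by (rule area_S2.integral_quadratic_form_nonneg[OF \<Theta>_meas _ _ w, where b = b])
           (use L2_S2_integrable_norm[OF b_L2] \<Theta>_le in auto)
      also have "\<dots> = (LINT p|(area_S2 \<Otimes>\<^sub>M area_S2). w (fst p) * w (snd p) * (H (fst p) (snd p) - R (fst p) (snd p)))"
        by (intro Bochner_Integration.integral_cong refl)
           (auto simp: space_pair_measure \<Theta>\<Theta>[unfolded L2_inner_def])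
      finally show ?thesis by (simp add: R_def)
    qed
  qed (use J f_meas BH in auto)
  then show ?thesis by (simp add: f_def)
qed

end

text \<open>A suitable g exists for every kernel, and the bound mentions neither g nor k, so the
  kernel may be varied.\<close>

lemma (in zonal_probability_kernel) Lieb_Thirring_zonal_conv:
  fixes \<phi> :: "'i \<Rightarrow> real^3 \<Rightarrow> real"
  assumes m: "m > 0" and J: "finite J"
    and grad: "\<And>j. j \<in> J \<Longrightarrow> has_weak_surface_gradient (\<phi> j) (G j)"
    and mean: "\<And>j. j \<in> J \<Longrightarrow> (LINT s|area_S2. \<phi> j s) = 0"
    and orth: "\<And>i j. i \<in> J \<Longrightarrow> j \<in> J \<Longrightarrow>
      m\<^sup>2 * L2_inner (\<phi> i) (\<phi> j) + L2_inner (G i) (G j) = (if i = j then 1 else 0)"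
  shows "(LINT s|area_S2. (\<Sum>j\<in>J. (zonal_conv k (\<phi> j) s)\<^sup>2)\<^sup>2) \<le> real (card J) / (4 * pi * m\<^sup>2)"
proof -
  obtain g where "zonal_green_function k m g"
    using green_function_polynomial[OF m nonneg poly_int_eq] m
    by (metis zonal_green_function.intro zonal_green_function_axioms.intro zonal_probability_kernel_axioms)
  then show ?thesis
    by (rule zonal_green_function.Lieb_Thirring_zonal_conv[OF _ J grad mean orth])
qed

section \<open>Removal of the smoothing\<close>

lemma L2_dist_triangle:
  fixes f g h :: "real^3 \<Rightarrow> real"
  assumes f: "f \<in> L2_S2" and g: "g \<in> L2_S2" and h: "h \<in> L2_S2"
  shows "(LINT s|area_S2. (f s - h s)\<^sup>2) \<le> 2 * (LINT s|area_S2. (f s - g s)\<^sup>2) + 2 * (LINT s|area_S2. (g s - h s)\<^sup>2)"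
proof -
  have int: "integrable area_S2 (\<lambda>s. (u s - v s)\<^sup>2)" if "u \<in> L2_S2" "v \<in> L2_S2" for u v :: "real^3 \<Rightarrow> real"
    using L2_S2_integrable_norm[OF L2_S2_diff[OF that]] by simp
  have "(f s - h s)\<^sup>2 \<le> 2 * (f s - g s)\<^sup>2 + 2 * (g s - h s)\<^sup>2" for s
    using zero_le_power2[of "(f s - g s) - (g s - h s)"] by (simp add: power2_eq_square algebra_simps)
  then have "(LINT s|area_S2. (f s - h s)\<^sup>2) \<le> (LINT s|area_S2. 2 * (f s - g s)\<^sup>2 + 2 * (g s - h s)\<^sup>2)"
    by (intro integral_mono int f h Bochner_Integration.integrable_add integrable_mult_right g)
  then show ?thesis
    using int[OF f g] int[OF g h] by simp
qed

text \<open>Meaningful for members of \<open>L2_S2\<close>: if the squared difference is not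
  integrable, its Bochner integral is 0 and the inequality holds trivially. Membership is therefore
  tracked separately.\<close>

definition L2_approximable :: "(real^3 \<Rightarrow> real) \<Rightarrow> bool" where
  "L2_approximable f \<longleftrightarrow> (\<forall>e>0. \<exists>h. continuous_on UNIV h \<and> (LINT s|area_S2. (f s - h s)\<^sup>2) < e)"

lemma L2_approximable_continuous: "continuous_on UNIV f \<Longrightarrow> L2_approximable f"
  unfolding L2_approximable_def by (auto intro!: exI[of _ f])

lemma L2_approximable_add:
  assumes f: "f \<in> L2_S2" "L2_approximable f" and g: "g \<in> L2_S2" "L2_approximable g"
  shows "L2_approximable (\<lambda>s. f s + g s)"
  unfolding L2_approximable_def
proof (intro allI impI)
  fix e :: real assume "e > 0"
  then have e: "e / 4 > 0" by simp
  obtain u where u: "continuous_on UNIV u" "(LINT s|area_S2. (f s - u s)\<^sup>2) < e / 4"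
    using f(2) e unfolding L2_approximable_def by blast
  obtain v where v: "continuous_on UNIV v" "(LINT s|area_S2. (g s - v s)\<^sup>2) < e / 4"
    using g(2) e unfolding L2_approximable_def by blast
  note L2 = f(1) g(1) L2_S2_continuous[OF u(1)] L2_S2_continuous[OF v(1)]
  have "(LINT s|area_S2. ((f s + g s) - (u s + v s))\<^sup>2)
      \<le> 2 * (LINT s|area_S2. ((f s + g s) - (u s + g s))\<^sup>2) + 2 * (LINT s|area_S2. ((u s + g s) - (u s + v s))\<^sup>2)"
    by (intro L2_dist_triangle L2_S2_add L2)
  also have "\<dots> < e" using u(2) v(2) by simp
  finally show "\<exists>h. continuous_on UNIV h \<and> (LINT s|area_S2. (f s + g s - h s)\<^sup>2) < e"
    using u(1) v(1) by (intro exI[of _ "\<lambda>s. u s + v s"]) (auto intro!: continuous_intros)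
qed

lemma L2_approximable_cmult:
  assumes f: "L2_approximable f"
  shows "L2_approximable (\<lambda>s. c * f s)"
  unfolding L2_approximable_def
proof (intro allI impI)
  fix e :: real assume e: "e > 0"
  obtain u where u: "continuous_on UNIV u" "(LINT s|area_S2. (f s - u s)\<^sup>2) < e / (c\<^sup>2 + 1)"
  proof -
    have "e / (c\<^sup>2 + 1) > 0" using e by (simp add: add_nonneg_pos)
    then show ?thesis using f that unfolding L2_approximable_def by blast
  qed
  have "(LINT s|area_S2. (c * f s - c * u s)\<^sup>2) = c\<^sup>2 * (LINT s|area_S2. (f s - u s)\<^sup>2)"
    by (simp add: right_diff_distrib[symmetric] power_mult_distrib)
  also have "\<dots> \<le> c\<^sup>2 * (e / (c\<^sup>2 + 1))"
    using u(2) by (intro mult_left_mono) auto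
  also have "\<dots> < e"
    using e by (simp add: pos_divide_less_eq add_nonneg_pos distrib_left mult.commute)
  finally show "\<exists>h. continuous_on UNIV h \<and> (LINT s|area_S2. (c * f s - h s)\<^sup>2) < e"
    using u(1) by (intro exI[of _ "\<lambda>s. c * u s"]) (auto intro!: continuous_intros)
qed

text \<open>Some F n is close to f by dominated convergence, and a continuous function is close to F
  n. This one closure step serves closed sets, countable unions and monotone limits.\<close>

lemma L2_approximable_dominated_limit:
  assumes F: "\<And>n. F n \<in> L2_S2" "\<And>n. L2_approximable (F n)" and f: "f \<in> L2_S2"
    and lim: "\<And>s. s \<in> S2 \<Longrightarrow> (\<lambda>n. F n s) \<longlonglongrightarrow> f s"
    and w: "integrable area_S2 w" "\<And>n s. s \<in> S2 \<Longrightarrow> (f s - F n s)\<^sup>2 \<le> w s"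
  shows "L2_approximable f"
  unfolding L2_approximable_def
proof (intro allI impI)
  fix e :: real assume e: "e > 0"
  note [measurable] = L2_S2_measurable[OF F(1)] L2_S2_measurable[OF f]
  have "(\<lambda>n. LINT s|area_S2. (f s - F n s)\<^sup>2) \<longlonglongrightarrow> (LINT s|area_S2. 0)"
  proof (rule integral_dominated_convergence[where w = w])
    show "AE s in area_S2. (\<lambda>n. (f s - F n s)\<^sup>2) \<longlonglongrightarrow> 0"
    proof (rule AE_I2)
      fix s assume "s \<in> space area_S2"
      then have "(\<lambda>n. (f s - F n s)\<^sup>2) \<longlonglongrightarrow> (f s - f s)\<^sup>2"
        by (intro tendsto_intros lim) simp
      then show "(\<lambda>n. (f s - F n s)\<^sup>2) \<longlonglongrightarrow> 0" by simp
    qed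
  qed (use w in auto)
  then have "\<forall>\<^sub>F n in sequentially. (LINT s|area_S2. (f s - F n s)\<^sup>2) < e / 4"
    by (intro order_tendstoD(2)) (use e in auto)
  then obtain n where n: "(LINT s|area_S2. (f s - F n s)\<^sup>2) < e / 4"
    using eventually_happens'[OF sequentially_bot] by blast
  obtain u where u: "continuous_on UNIV u" "(LINT s|area_S2. (F n s - u s)\<^sup>2) < e / 4"
    using F(2)[of n] e unfolding L2_approximable_def by (meson divide_pos_pos zero_less_numeral)
  have "(LINT s|area_S2. (f s - u s)\<^sup>2) < e"
    using L2_dist_triangle[OF f F(1)[of n] L2_S2_continuous[OF u(1)]] n u(2) by linarith
  then show "\<exists>h. continuous_on UNIV h \<and> (LINT s|area_S2. (f s - h s)\<^sup>2) < e"
    using u(1) by blast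
qed

lemma L2_approximable_cong:
  assumes "L2_approximable f" "\<And>s. s \<in> S2 \<Longrightarrow> f s = g s"
  shows "L2_approximable g"
proof -
  have "(LINT s|area_S2. (f s - h s)\<^sup>2) = (LINT s|area_S2. (g s - h s)\<^sup>2)" for h
    by (intro Bochner_Integration.integral_cong refl) (simp add: assms(2))
  then show ?thesis using assms(1) by (simp add: L2_approximable_def)
qed

lemma indicator_L2:
  fixes A :: "(real^3) set"
  assumes "A \<in> sets borel"
  shows "(indicator A :: _ \<Rightarrow> real) \<in> L2_S2"
  by (rule L2_S2_bounded[where B = 1])
     (use borel_measurable_area_S2[OF borel_measurable_indicator[OF assms]] in \<open>auto simp: indicator_def\<close>)

text \<open>The continuous approximants are 1 on A and 0 at distance at least 1/n from it. For empty
  A, \<open>infdist\<close> is 0 and they would be constantly 1, so that case is excluded.\<close>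

lemma L2_approximable_indicator_closed:
  fixes A :: "(real^3) set"
  assumes "closed A" "A \<noteq> {}"
  shows "L2_approximable (indicator A)"
proof (rule L2_approximable_dominated_limit[where F = "\<lambda>n s. max 0 (1 - real n * infdist s A)" and w = "\<lambda>_. 1"])
  show "(\<lambda>s. max 0 (1 - real n * infdist s A)) \<in> L2_S2" "L2_approximable (\<lambda>s. max 0 (1 - real n * infdist s A))" for n
    by (intro L2_S2_continuous L2_approximable_continuous continuous_intros)+
  show "(indicator A :: _ \<Rightarrow> real) \<in> L2_S2"
    using assms by (intro indicator_L2) simp
  show "(\<lambda>n. max 0 (1 - real n * infdist s A)) \<longlonglongrightarrow> indicator A s" for s
  proof (cases "s \<in> A")
    case False
    then have d: "infdist s A > 0"
      using assms by (simp add: infdist_pos_not_in_closed)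
    obtain N where N: "real N * infdist s A > 1"
      using reals_Archimedean3[OF d] by blast
    have "max 0 (1 - real n * infdist s A) = 0" if "n \<ge> N" for n
    proof -
      have "real N * infdist s A \<le> real n * infdist s A"
        using that d by (intro mult_right_mono) auto
      then show ?thesis using N by simp
    qed
    then have "\<forall>\<^sub>F n in sequentially. max 0 (1 - real n * infdist s A) = 0"
      unfolding eventually_sequentially by blast
    then show ?thesis
      using False by (simp add: tendsto_eventually)
  qed simp
  show "(indicator A s - max 0 (1 - real n * infdist s A))\<^sup>2 \<le> 1" for n s
  proof -
    have "0 \<le> max 0 (1 - real n * infdist s A)" "max 0 (1 - real n * infdist s A) \<le> 1"
      using infdist_nonneg[of s A] by auto
    then have "\<bar>indicator A s - max 0 (1 - real n * infdist s A)\<bar> \<le> 1"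
      by (cases "s \<in> A") auto
    then show ?thesis by (simp add: abs_square_le_1)
  qed
qed auto

text \<open>Dynkin's argument: closed sets generate the Borel sets and are stable under
  intersection. Complements and disjoint countable unions preserve approximability, with the
  constant 1 as dominating function.\<close>

lemma L2_approximable_indicator:
  fixes A :: "(real^3) set"
  assumes "A \<in> sets borel"
  shows "L2_approximable (indicator A)"
proof -
  have A: "A \<in> sigma_sets UNIV (Collect closed)"
    using assms by (simp add: borel_eq_closed)
  have borel: "sigma_sets UNIV (Collect closed) = sets (borel :: (real^3) measure)"
    by (simp add: borel_eq_closed)
  have "Int_stable (Collect closed :: (real^3) set set)" by (auto simp: Int_stable_def)
  moreover have "(Collect closed :: (real^3) set set) \<subseteq> Pow UNIV" by simp
  ultimately show ?thesis using A
  proof (induction rule: sigma_sets_induct_disjoint)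
    case (basic A)
    then show ?case
      using L2_approximable_indicator_closed L2_approximable_continuous[of "\<lambda>_. 0"]
      by (cases "A = {}") auto
  next
    case empty
    then show ?case using L2_approximable_continuous[of "\<lambda>_. 0"] by simp
  next
    case (compl A)
    then have "L2_approximable (\<lambda>s. 1 + (-1) * indicator A s)"
      using L2_S2_scaleR[OF indicator_L2, of A "-1"] compl.IH
      by (intro L2_approximable_add L2_approximable_cmult L2_approximable_continuous[of "\<lambda>_. 1"])
         (auto simp: borel L2_S2_continuous)
    then show ?case by (rule L2_approximable_cong) (auto simp: indicator_def)
  next
    case (union A)
    have A: "A i \<in> sets borel" for i using union.hyps(2) by (auto simp: borel)
    have fin: "L2_approximable (indicator (\<Union>i<n. A i))" for n
    proof (induction n)
      case 0
      show ?case using L2_approximable_continuous[of "\<lambda>_. 0"] by simp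
    next
      case (Suc n)
      have "L2_approximable (\<lambda>s. indicator (\<Union>i<n. A i) s + indicator (A n) s)"
        using Suc union.IH A by (intro L2_approximable_add indicator_L2) auto
      then show ?case
      proof (rule L2_approximable_cong)
        have "A i \<inter> A n = {}" if "i < n" for i
          using disjoint_family_onD[OF union.hyps(1), of i n] that by simp
        then have "(\<Union>i<n. A i) \<inter> A n = {}"
          by blast
        then show "indicator (\<Union>i<n. A i) s + indicator (A n) s = (indicator (\<Union>i<Suc n. A i) s :: real)" for s
          unfolding lessThan_Suc UN_insert by (subst indicator_add[symmetric]) (simp_all add: Un_commute Int_commute)
      qed
    qed
    show ?case
    proof (rule L2_approximable_dominated_limit[where F = "\<lambda>n. indicator (\<Union>i<n. A i)" and w = "\<lambda>_. 1"])
      show "(indicator (\<Union>i<n. A i) :: _ \<Rightarrow> real) \<in> L2_S2" "(indicator (\<Union>i. A i) :: _ \<Rightarrow> real) \<in> L2_S2" for n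
        using A by (auto intro!: indicator_L2)
      show "(\<lambda>n. indicator (\<Union>i<n. A i) s) \<longlonglongrightarrow> (indicator (\<Union>i. A i) s :: real)" for s
        by (rule LIMSEQ_indicator_UN)
      show "(indicator (\<Union>i. A i) s - indicator (\<Union>i<n. A i) s)\<^sup>2 \<le> (1 :: real)" for n s
        by (auto simp: indicator_def)
    qed (auto simp: fin)
  qed
qed

lemma L2_approximable_nonneg:
  assumes "f \<in> L2_S2" "\<And>s. f s \<ge> 0"
  shows "L2_approximable f"
proof -
  have "f \<in> borel_measurable area_S2"
    by (rule L2_S2_measurable[OF assms(1)])
  \<comment> \<open>Square integrability stays a premise inside the induction, because each building
    block must inherit it from the larger function that it composes.\<close>
  from this assms(2) have "f \<in> L2_S2 \<longrightarrow> L2_approximable f"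
  proof (induction rule: borel_measurable_induct_real)
    case (set A)
    then obtain B where "B \<in> sets borel" "A = S2 \<inter> B"
      by (auto simp: sets_restrict_space)
    then have "L2_approximable (indicator A)"
      by (intro L2_approximable_cong[OF L2_approximable_indicator[of B]]) (auto simp: indicator_def)
    then show ?case ..
  next
    case (mult u c)
    show ?case
    \<comment> \<open>For c = 0 the product says nothing about square integrability of u; otherwise
      u is recovered from c u by division.\<close>
    proof (cases "c = 0")
      case True
      then show ?thesis using L2_approximable_continuous[of "\<lambda>_. 0"] by simp
    next
      case False
      then show ?thesis
        using mult L2_S2_scaleR[of "\<lambda>s. c * u s" "1 / c"] by (auto intro!: L2_approximable_cmult)
    qed
  next
    case (add u v)
    show ?case
    proof
      assume "(\<lambda>s. v s + u s) \<in> L2_S2"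
      note int = L2_S2_integrable_norm[OF this]
      have "u \<in> L2_S2" "v \<in> L2_S2"
        using add by (auto intro!: L2_S2_bound[OF _ int] power_mono)
      then show "L2_approximable (\<lambda>s. v s + u s)"
        using add by (intro L2_approximable_add) auto
    qed
  next
    case (seq U)
    show ?case
    proof
      assume f: "f \<in> L2_S2"
      note int = L2_S2_integrable_norm[OF f]
      have U_le: "U n s \<le> f s" if "s \<in> S2" for n s
        using seq.hyps(3,4) that by (intro incseq_le[of "\<lambda>n. U n s"]) (auto simp: incseq_def le_fun_def)
      have U: "U n \<in> L2_S2" for n
        using seq.hyps(1,2) U_le by (auto intro!: L2_S2_bound[OF _ int] power_mono order.trans[OF _ abs_ge_self])
      show "L2_approximable f"
      proof (rule L2_approximable_dominated_limit[OF U _ f])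
        show "L2_approximable (U n)" for n using seq.IH U by blast
        show "(\<lambda>n. U n s) \<longlonglongrightarrow> f s" if "s \<in> S2" for s using seq.hyps(4) that by simp
        show "(f s - U n s)\<^sup>2 \<le> (norm (f s))\<^sup>2" if "s \<in> S2" for n s
          using U_le[OF that] seq.hyps(2) by (auto intro!: power_mono)
      qed (rule int)
    qed
  qed
  with assms(1) show ?thesis by blast
qed

lemma L2_approximable:
  assumes f: "f \<in> L2_S2"
  shows "L2_approximable f"
proof -
  note [measurable] = L2_S2_measurable[OF f]
  have L2: "(\<lambda>s. max 0 (c * f s)) \<in> L2_S2" if "c = 1 \<or> c = -1" for c
    by (rule L2_S2_bound[OF _ L2_S2_integrable_norm[OF f]])
       (use that in \<open>auto simp: max_def\<close>)
  have "L2_approximable (\<lambda>s. max 0 (1 * f s) + (-1) * max 0 (-1 * f s))"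
    using L2_S2_scaleR[OF L2[of "-1"], of "-1"] L2[of 1] L2[of "-1"]
    by (intro L2_approximable_add L2_approximable_cmult L2_approximable_nonneg) auto
  then show ?thesis
    by (rule L2_approximable_cong) (auto simp: max_def)
qed

section \<open>Convergence of the smoothed functions\<close>

lemma zonal_conv_power2_L2:
  assumes f: "f \<in> L2_S2"
  shows "(\<lambda>s. (zonal_conv k f s)\<^sup>2) \<in> L2_S2"
proof -
  obtain B where B: "\<And>s. s \<in> S2 \<Longrightarrow> \<bar>zonal_conv k f s\<bar> \<le> B"
    using zonal_conv_bounded[OF f] by blast
  note [measurable] = zonal_conv_measurable[OF L2_S2_measurable[OF f]]
  have "\<bar>zonal_conv k f s\<bar>\<^sup>2 \<le> B\<^sup>2" if "s \<in> S2" for s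
    using B[OF that] by (intro power_mono) auto
  then show ?thesis
    by (intro L2_S2_bounded[where B = "B\<^sup>2"]) auto
qed

text \<open>The base (1 + x)/2 is 1 at x = 1, that is at t = s, and smaller elsewhere on [-1,1], so
  the powers concentrate there. The integral of the power is 2/(N+1), which fixes the
  prefactor.\<close>

definition power_kernel :: "nat \<Rightarrow> real poly" where
  "power_kernel N = smult ((real N + 1) / (4 * pi)) ([:1/2, 1/2:] ^ N)"

lemma poly_power_kernel: "poly (power_kernel N) x = (real N + 1) / (4 * pi) * ((1 + x) / 2) ^ N"
  by (simp add: power_kernel_def add_divide_distrib)

lemma zonal_probability_kernel_power_kernel: "zonal_probability_kernel (power_kernel N)"
proof
  show "poly (power_kernel N) x \<ge> 0" if "x \<in> {-1..1}" for x
    using that by (simp add: poly_power_kernel)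
  have "pderiv ([:1/2, 1/2 :: real:] ^ Suc N) = smult ((real N + 1) / 2) ([:1/2, 1/2:] ^ N)"
    by (simp add: pderiv_power_Suc pderiv_pCons add.commute del: power_Suc)
  then have "(real N + 1) / 2 * poly_int ([:1/2, 1/2:] ^ N) = 1"
    using poly_int_pderiv[of "[:1/2, 1/2 :: real:] ^ Suc N"] by (simp add: poly_int_smult)
  then show "poly_int (power_kernel N) = 1 / (2 * pi)"
    by (simp add: power_kernel_def poly_int_smult field_simps)
qed

text \<open>Near s the uniform continuity of h gives an error of e/2; away from s the kernel is at
  most a multiple of (N+1) q^N with q < 1, and h is bounded.\<close>

lemma zonal_conv_power_kernel_uniform:
  assumes h: "continuous_on UNIV h" and e: "e > 0"
  shows "\<forall>\<^sub>F N in sequentially. \<forall>s\<in>S2. \<bar>zonal_conv (power_kernel N) h s - h s\<bar> \<le> e"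
proof -
  have "uniformly_continuous_on S2 h"
    by (intro compact_uniformly_continuous compact_S2 continuous_on_subset[OF h]) simp
  then obtain d0 where d0: "d0 > 0" "\<And>s t. s \<in> S2 \<Longrightarrow> t \<in> S2 \<Longrightarrow> dist t s < d0 \<Longrightarrow> dist (h t) (h s) < e / 2"
    using e unfolding uniformly_continuous_on_def by (metis half_gt_zero)
  \<comment> \<open>The cap at 1 keeps q nonnegative.\<close>
  define d where "d = min d0 1"
  have d: "d > 0" "d \<le> 1" "d \<le> d0" using d0(1) by (auto simp: d_def)
  have "bounded (h ` S2)"
    by (intro compact_imp_bounded compact_continuous_image compact_S2 continuous_on_subset[OF h]) simp
  then obtain B where B: "\<And>s. s \<in> S2 \<Longrightarrow> \<bar>h s\<bar> \<le> B"
    by (auto simp: bounded_iff)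
  \<comment> \<open>On the sphere |t - s|^2 = 2 - 2 (s \<bullet> t), so |t - s| >= d means that (1 +
    s \<bullet> t)/2 is at most q.\<close>
  define q where "q = 1 - d\<^sup>2 / 4"
  have "d\<^sup>2 \<le> 1" using d by (simp add: power_le_one)
  then have q: "0 \<le> q" "q < 1" using d(1) by (auto simp: q_def)
  \<comment> \<open>The far contribution: oscillation 2 B of h, times the kernel bound, times the
    area 4 pi.\<close>
  define \<epsilon> where "\<epsilon> = (\<lambda>N. 2 * B * ((real N + 1) / (4 * pi) * q ^ N) * (4 * pi))"
  have "(\<lambda>N. 2 * B * (real N * q ^ N + q ^ N)) \<longlonglongrightarrow> 2 * B * (0 + 0)"
    using q by (intro tendsto_intros powser_times_n_limit_0 LIMSEQ_power_zero) auto
  moreover have "\<epsilon> = (\<lambda>N. 2 * B * (real N * q ^ N + q ^ N))"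
    by (simp add: \<epsilon>_def fun_eq_iff field_simps)
  ultimately have "\<epsilon> \<longlonglongrightarrow> 0"
    by simp
  then have "\<forall>\<^sub>F N in sequentially. \<epsilon> N < e / 2"
    using e by (intro order_tendstoD(2)) auto
  then show ?thesis
  proof eventually_elim
    case (elim N)
    interpret zonal_probability_kernel "power_kernel N"
      by (rule zonal_probability_kernel_power_kernel)
    let ?k = "\<lambda>s t. poly (power_kernel N) (s \<bullet> t)"
    define c where "c = 2 * B * ((real N + 1) / (4 * pi) * q ^ N)"
    show ?case
    proof
      fix s assume s: "s \<in> S2"
      have hL2: "h \<in> L2_S2" by (rule L2_S2_continuous[OF h])
      have int: "integrable area_S2 (\<lambda>t. ?k s t * h t)" "integrable area_S2 (\<lambda>t. ?k s t)"
        by (intro L2_S2_integrable_mult L2_S2_integrable L2_S2_zonal hL2)+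
      have int': "integrable area_S2 (\<lambda>t. ?k s t * (h t - h s))"
        using int by (simp add: right_diff_distrib)
      have B0: "B \<ge> 0" using B[OF s] by simp
      have pt: "\<bar>?k s t * (h t - h s)\<bar> \<le> ?k s t * (e / 2) + c" if t: "t \<in> S2" for t
      proof (cases "dist t s < d0")
        case True
        have "c \<ge> 0" using B0 q(1) by (simp add: c_def)
        moreover have "\<bar>?k s t * (h t - h s)\<bar> \<le> ?k s t * (e / 2)"
          unfolding abs_mult abs_of_nonneg[OF kernel_nonneg[OF s t]]
          using d0(2)[OF s t True] kernel_nonneg[OF s t]
          by (intro mult_left_mono) (simp_all add: dist_real_def)
        ultimately show ?thesis by simp
      next
        case False
        have "(dist t s)\<^sup>2 = 2 - 2 * (s \<bullet> t)"
          using s t by (simp add: S2_def dist_norm power2_norm_eq_inner inner_diff_left inner_diff_right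
              inner_commute norm_eq_1)
        moreover have "d\<^sup>2 \<le> (dist t s)\<^sup>2"
          using False d by (intro power_mono) auto
        ultimately have "(1 + s \<bullet> t) / 2 \<le> q" by (simp add: q_def)
        moreover have "0 \<le> (1 + s \<bullet> t) / 2" using inner_S2_bounds[OF s t] by simp
        ultimately have "?k s t \<le> (real N + 1) / (4 * pi) * q ^ N"
          unfolding poly_power_kernel by (intro mult_left_mono power_mono) auto
        moreover have "\<bar>h t - h s\<bar> \<le> 2 * B" using B[OF s] B[OF t] by linarith
        ultimately have "?k s t * \<bar>h t - h s\<bar> \<le> (real N + 1) / (4 * pi) * q ^ N * (2 * B)"
          using kernel_nonneg[OF s t] q(1) by (intro mult_mono) auto
        then have "\<bar>?k s t * (h t - h s)\<bar> \<le> c"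
          using kernel_nonneg[OF s t] by (simp add: abs_mult c_def mult_ac)
        moreover have "?k s t * (e / 2) \<ge> 0" using kernel_nonneg[OF s t] e by simp
        ultimately show ?thesis by linarith
      qed
      have "zonal_conv (power_kernel N) h s - h s = (LINT t|area_S2. ?k s t * (h t - h s))"
        using int by (simp add: zonal_conv_def right_diff_distrib integral_kernel[OF s])
      also have "\<bar>\<dots>\<bar> \<le> (LINT t|area_S2. \<bar>?k s t * (h t - h s)\<bar>)"
        by (rule integral_abs_bound)
      also have "\<dots> \<le> (LINT t|area_S2. ?k s t * (e / 2) + c)"
        using int(2) pt by (intro integral_mono integrable_abs int') auto
      also have "\<dots> = e / 2 + \<epsilon> N"
        using int(2) by (simp add: integral_kernel[OF s] measure_area_S2 c_def \<epsilon>_def)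
      finally show "\<bar>zonal_conv (power_kernel N) h s - h s\<bar> \<le> e"
        using elim by simp
    qed
  qed
qed

text \<open>Uniform convergence for a continuous h near f extends to f because every smoothing
  operator is a contraction.\<close>

lemma zonal_conv_power_kernel_L2:
  assumes f: "f \<in> L2_S2"
  shows "(\<lambda>N. LINT s|area_S2. (zonal_conv (power_kernel N) f s - f s)\<^sup>2) \<longlonglongrightarrow> 0"
proof (rule tendstoI, simp add: dist_real_def)
  fix e :: real assume e: "e > 0"
  obtain h where h: "continuous_on UNIV h" "(LINT s|area_S2. (f s - h s)\<^sup>2) < e / 16"
    using L2_approximable[OF f] e unfolding L2_approximable_def by (meson divide_pos_pos zero_less_numeral)
  have hL2: "h \<in> L2_S2" by (rule L2_S2_continuous[OF h(1)])
  \<comment> \<open>Chosen so that e'^2 times the area 4 pi is e/8; the two triangle inequalities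
    then give at most 2 (e/16) + 4 (e/8) + 4 (e/16) < e.\<close>
  define e' where "e' = sqrt (e / (32 * pi))"
  have e': "e' > 0" "e'\<^sup>2 = e / (32 * pi)" using e by (auto simp: e'_def)
  show "\<forall>\<^sub>F N in sequentially. (LINT s|area_S2. (zonal_conv (power_kernel N) f s - f s)\<^sup>2) < e"
    using zonal_conv_power_kernel_uniform[OF h(1) e'(1)]
  proof eventually_elim
    case (elim N)
    interpret zonal_probability_kernel "power_kernel N"
      by (rule zonal_probability_kernel_power_kernel)
    let ?K = "zonal_conv (power_kernel N)"
    have "(LINT s|area_S2. (?K f s - ?K h s)\<^sup>2) = (LINT s|area_S2. (?K (\<lambda>t. f t - h t) s)\<^sup>2)"
      by (simp add: zonal_conv_diff f hL2)
    also have "\<dots> \<le> (LINT s|area_S2. (f s - h s)\<^sup>2)"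
      by (intro zonal_conv_contraction L2_S2_diff f hL2)
    finally have 1: "(LINT s|area_S2. (?K f s - ?K h s)\<^sup>2) < e / 16" using h(2) by simp
    have "(LINT s|area_S2. (?K h s - h s)\<^sup>2) \<le> (LINT s|area_S2. e'\<^sup>2)"
    proof (rule integral_mono)
      show "integrable area_S2 (\<lambda>s. (?K h s - h s)\<^sup>2)"
        using L2_S2_integrable_norm[OF L2_S2_diff[OF zonal_conv_L2[OF hL2] hL2]] by simp
      show "(?K h s - h s)\<^sup>2 \<le> e'\<^sup>2" if "s \<in> space area_S2" for s
        using elim that e'(1) by (simp add: abs_le_square_iff[symmetric])
    qed simp
    also have "\<dots> = e / 8"
      by (simp add: e'(2) measure_area_S2)
    finally have 2: "(LINT s|area_S2. (?K h s - h s)\<^sup>2) \<le> e / 8" .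
    have 3: "(LINT s|area_S2. (h s - f s)\<^sup>2) < e / 16"
      using h(2) by (simp add: power2_commute)
    have "(LINT s|area_S2. (?K f s - f s)\<^sup>2)
        \<le> 2 * (LINT s|area_S2. (?K f s - ?K h s)\<^sup>2) + 2 * (LINT s|area_S2. (?K h s - f s)\<^sup>2)"
      by (intro L2_dist_triangle zonal_conv_L2 f hL2)
    moreover have "(LINT s|area_S2. (?K h s - f s)\<^sup>2)
        \<le> 2 * (LINT s|area_S2. (?K h s - h s)\<^sup>2) + 2 * (LINT s|area_S2. (h s - f s)\<^sup>2)"
      by (intro L2_dist_triangle zonal_conv_L2 f hL2)
    ultimately show "(LINT s|area_S2. (?K f s - f s)\<^sup>2) < e"
      using 1 2 3 e by linarith
  qed
qed

theorem theorem4p2: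
  fixes m :: real and n :: nat and \<phi> :: "nat \<Rightarrow> real^3 \<Rightarrow> real"
  assumes "m > 0"
    and "\<And>j. j \<in> {1..n} \<Longrightarrow> \<phi> j \<in> H1_S2"
    and "\<And>j. j \<in> {1..n} \<Longrightarrow> (LINT s|area_S2. \<phi> j s) = 0"
    and "\<And>i j. i \<in> {1..n} \<Longrightarrow> j \<in> {1..n} \<Longrightarrow>
           m\<^sup>2 * L2_inner (\<phi> i) (\<phi> j) + L2_inner (surface_grad (\<phi> i)) (surface_grad (\<phi> j))
             = (if i = j then 1 else 0)"
  shows "(\<lambda>s. \<Sum>j=1..n. \<bar>\<phi> j s\<bar>\<^sup>2) \<in> L2_S2 \<and>
         L2_norm (\<lambda>s. \<Sum>j=1..n. \<bar>\<phi> j s\<bar>\<^sup>2) \<le> 1 / (2 * sqrt pi) * inverse m * sqrt (real n)"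
proof -
  let ?J = "{1..n}"
  let ?K = "\<lambda>N. zonal_conv (power_kernel N)"
  have grad: "has_weak_surface_gradient (\<phi> j) (surface_grad (\<phi> j))" if "j \<in> ?J" for j
    using assms(2)[OF that] unfolding H1_S2_def surface_grad_def mem_Collect_eq by (rule someI_ex)
  have \<phi>: "\<phi> j \<in> L2_S2" if "j \<in> ?J" for j
    using grad[OF that] by (simp add: has_weak_surface_gradient_def)
  define E where "E = real n / (4 * pi * m\<^sup>2)"
  define \<rho> where "\<rho> = (\<lambda>s. \<Sum>j\<in>?J. (\<phi> j s)\<^sup>2)"
  define \<rho>' where "\<rho>' = (\<lambda>N s. \<Sum>j\<in>?J. (?K N (\<phi> j) s)\<^sup>2)"
  have bound: "(LINT s|area_S2. (\<rho>' N s)\<^sup>2) \<le> E" for N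
  proof -
    interpret zonal_probability_kernel "power_kernel N"
      by (rule zonal_probability_kernel_power_kernel)
    have "(LINT s|area_S2. (\<rho>' N s)\<^sup>2) \<le> real (card ?J) / (4 * pi * m\<^sup>2)"
      unfolding \<rho>'_def by (rule Lieb_Thirring_zonal_conv[OF assms(1) _ grad assms(3,4)]) simp_all
    then show ?thesis by (simp add: E_def)
  qed
  \<comment> \<open>One function dominates all the squared errors. Its convergence in L1 yields a
    single subsequence along which every smoothed function converges almost everywhere.\<close>
  define u where "u = (\<lambda>N s. \<Sum>j\<in>?J. (?K N (\<phi> j) s - \<phi> j s)\<^sup>2)"
  have u_int: "integrable area_S2 (\<lambda>s. (?K N (\<phi> j) s - \<phi> j s)\<^sup>2)" if "j \<in> ?J" for j N
    using L2_S2_integrable_norm[OF L2_S2_diff[OF zonal_conv_L2[OF \<phi>[OF that]] \<phi>[OF that]]] by simp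
  have "(\<lambda>N. LINT s|area_S2. norm (u N s)) \<longlonglongrightarrow> 0"
  proof -
    have "(\<lambda>N. \<Sum>j\<in>?J. (LINT s|area_S2. (?K N (\<phi> j) s - \<phi> j s)\<^sup>2)) \<longlonglongrightarrow> (\<Sum>j\<in>?J. 0)"
      by (intro tendsto_sum zonal_conv_power_kernel_L2 \<phi>)
    moreover have "(LINT s|area_S2. norm (u N s)) = (\<Sum>j\<in>?J. (LINT s|area_S2. (?K N (\<phi> j) s - \<phi> j s)\<^sup>2))" for N
      using u_int by (simp add: u_def abs_of_nonneg sum_nonneg)
    ultimately show ?thesis by simp
  qed
  moreover have "integrable area_S2 (u N)" for N
    unfolding u_def by (intro Bochner_Integration.integrable_sum u_int)
  ultimately obtain r where r: "AE s in area_S2. (\<lambda>N. u (r N) s) \<longlonglongrightarrow> 0"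
    using tendsto_L1_AE_subseq[of area_S2 u] by blast
  have conv: "(\<lambda>N. \<rho>' (r N) s) \<longlonglongrightarrow> \<rho> s" if s: "(\<lambda>N. u (r N) s) \<longlonglongrightarrow> 0" for s
    unfolding \<rho>'_def \<rho>_def
  proof (intro tendsto_sum tendsto_power)
    fix j assume j: "j \<in> ?J"
    have "(\<lambda>N. (?K (r N) (\<phi> j) s - \<phi> j s)\<^sup>2) \<longlonglongrightarrow> 0"
    proof (rule tendsto_sandwich[OF _ _ tendsto_const s])
      show "\<forall>\<^sub>F N in sequentially. (?K (r N) (\<phi> j) s - \<phi> j s)\<^sup>2 \<le> u (r N) s"
        unfolding u_def using j by (intro always_eventually allI member_le_sum) auto
    qed simp
    then have "(\<lambda>N. sqrt ((?K (r N) (\<phi> j) s - \<phi> j s)\<^sup>2)) \<longlonglongrightarrow> sqrt 0"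
      by (rule tendsto_real_sqrt)
    then have "(\<lambda>N. ?K (r N) (\<phi> j) s - \<phi> j s) \<longlonglongrightarrow> 0"
      by (simp add: tendsto_rabs_zero_iff)
    then show "(\<lambda>N. ?K (r N) (\<phi> j) s) \<longlonglongrightarrow> \<phi> j s"
      by (rule LIM_zero_cancel)
  qed
  have \<rho>'_meas: "\<rho>' N \<in> borel_measurable area_S2" for N
    unfolding \<rho>'_def by (intro borel_measurable_sum borel_measurable_power zonal_conv_measurable L2_S2_measurable \<phi>)
  have \<rho>_meas: "\<rho> \<in> borel_measurable area_S2"
    unfolding \<rho>_def by (intro borel_measurable_sum borel_measurable_power L2_S2_measurable \<phi>)
  have \<rho>'_int: "integrable area_S2 (\<lambda>s. (\<rho>' N s)\<^sup>2)" for N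
  proof -
    have "\<rho>' N \<in> L2_S2"
      unfolding \<rho>'_def by (intro L2_S2_sum zonal_conv_power2_L2 \<phi>)
    from L2_S2_integrable_norm[OF this] show ?thesis by simp
  qed
  \<comment> \<open>Fatou is applied to extended nonnegative integrals since the square
    integrability of \<rho> is not known beforehand; it follows from this bound.\<close>
  have nn: "(\<integral>\<^sup>+s. ennreal ((\<rho> s)\<^sup>2) \<partial>area_S2) \<le> ennreal E"
  proof -
    have "(\<integral>\<^sup>+s. ennreal ((\<rho> s)\<^sup>2) \<partial>area_S2) = (\<integral>\<^sup>+s. liminf (\<lambda>N. ennreal ((\<rho>' (r N) s)\<^sup>2)) \<partial>area_S2)"
    proof (rule nn_integral_cong_AE, use r in eventually_elim)
      case (elim s)
      have "(\<lambda>N. ennreal ((\<rho>' (r N) s)\<^sup>2)) \<longlonglongrightarrow> ennreal ((\<rho> s)\<^sup>2)"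
        by (intro tendsto_ennrealI tendsto_power conv elim)
      from lim_imp_Liminf[OF sequentially_bot this]
      show "ennreal ((\<rho> s)\<^sup>2) = liminf (\<lambda>N. ennreal ((\<rho>' (r N) s)\<^sup>2))" ..
    qed
    also have "\<dots> \<le> liminf (\<lambda>N. \<integral>\<^sup>+s. ennreal ((\<rho>' (r N) s)\<^sup>2) \<partial>area_S2)"
      using \<rho>'_meas by (intro nn_integral_liminf) measurable
    also have "\<dots> \<le> ennreal E"
    proof (intro Liminf_le always_eventually allI)
      show "(\<integral>\<^sup>+s. ennreal ((\<rho>' (r N) s)\<^sup>2) \<partial>area_S2) \<le> ennreal E" for N
        using bound[of "r N"] by (subst nn_integral_eq_integral[OF \<rho>'_int]) (auto intro: ennreal_leI)
    qed simp
    finally show ?thesis .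
  qed
  have \<rho>_int: "integrable area_S2 (\<lambda>s. (\<rho> s)\<^sup>2)"
  proof (rule integrableI_bounded)
    show "(\<integral>\<^sup>+s. ennreal (norm ((\<rho> s)\<^sup>2)) \<partial>area_S2) < \<infinity>"
      using le_less_trans[OF nn ennreal_less_top] by simp
  qed (use \<rho>_meas in measurable)
  have "(LINT s|area_S2. (\<rho> s)\<^sup>2) \<le> E"
    using nn nn_integral_eq_integral[OF \<rho>_int] by (simp add: E_def)
  then have "L2_norm \<rho> \<le> sqrt E"
    by (simp add: L2_norm_def L2_inner_def power2_eq_square)
  also have "sqrt E = 1 / (2 * sqrt pi) * inverse m * sqrt (real n)"
    using assms(1) by (simp add: E_def real_sqrt_divide real_sqrt_mult field_simps)
  finally show ?thesis
    using \<rho>_int \<rho>_meas by (simp add: L2_S2_def \<rho>_def)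
qed

end
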